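(* The image of $\rho'_1=c\circ\rho_1:G(3_1)\to SO^0(1,2)$ acts on the hyperbolic plane $\mathbb H^2$ as the holonomy of the hyperbolic orbifold $S^2_{2,3,\infty}$.
   Context: $G(3_1)=\langle a,b\mid aba=bab\rangle$ is the trefoil knot group. $H=\left(\frac{-1,1}{\mathbb R}\right)\cong M(2,\mathbb R)$ is the quaternion algebra with basis $1,i,j,ij$, where $i^2=-1$, $j^2=1$, $ij=-ji$; its norm-one group is $U_1=SL(2,\mathbb R)$; $H_0\cong E^{1,2}$ is the space of pure quaternions with the norm as quadratic form (Minkowski space). The homomorphism $c:SL(2,\mathbb R)\to SO^0(1,2)\cong \mathrm{Iso}^+(\mathbb H^2)$ is $c(A)(v)=Av\overline{A}$, where $\overline A$ is the quaternion conjugate. The representation $\rho_1:G(3_1)\to SL(2,\mathbb R)$ is $\rho_1(a)=1+i+j$, $\rho_1(b)=1+\frac14(i-j)$. $S^2_{2,3,\infty}$ is the complete finite-area hyperbolic orbifold whose underlying space is a once-punctured 2-sphere (one cusp) with two cone points of orders $2$ and $3$; its holonomy is conjugate to the modular group $PSL(2,\mathbb Z)$ acting on $\mathbb H^2$. *)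

theory Defs
  imports "HOL-Analysis.Analysis" "HOL-Algebra.Group"
begin

section \<open>Groups given by generators and relations\<close>

text \<open>A letter \<open>(g, True)\<close> stands for the generator \<open>g\<close>, and \<open>(g, False)\<close> for its formal inverse.\<close>

type_synonym 'g word = "('g \<times> bool) list"

inductive word_equiv :: "('g word \<times> 'g word) set \<Rightarrow> 'g word \<Rightarrow> 'g word \<Rightarrow> bool"
  for R :: "('g word \<times> 'g word) set" where
  rel: "(u, v) \<in> R \<Longrightarrow> word_equiv R u v"
| cancel: "word_equiv R [(g, e), (g, \<not> e)] []"
| refl: "word_equiv R u u"
| sym: "word_equiv R u v \<Longrightarrow> word_equiv R v u"
| trans: "word_equiv R u v \<Longrightarrow> word_equiv R v w \<Longrightarrow> word_equiv R u w"
| append: "word_equiv R u u' \<Longrightarrow> word_equiv R v v' \<Longrightarrow> word_equiv R (u @ v) (u' @ v')"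

definition word_class :: "('g word \<times> 'g word) set \<Rightarrow> 'g word \<Rightarrow> 'g word set" where
  "word_class R u = {v. word_equiv R u v}"

definition presented_group :: "('g word \<times> 'g word) set \<Rightarrow> 'g word set monoid" where
  "presented_group R =
     \<lparr>carrier = range (word_class R),
      mult = (\<lambda>X Y. \<Union>u\<in>X. \<Union>v\<in>Y. word_class R (u @ v)),
      one = word_class R []\<rparr>"

lemma word_class_eq_iff: "word_class R u = word_class R v \<longleftrightarrow> word_equiv R u v"
proof
  assume "word_class R u = word_class R v"
  moreover have "v \<in> word_class R v"
    by (simp add: word_class_def word_equiv.refl)
  ultimately have "v \<in> word_class R u" by blast
  then show "word_equiv R u v"
    by (simp add: word_class_def)
next
  assume "word_equiv R u v"
  then show "word_class R u = word_class R v"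
    unfolding word_class_def by (intro Collect_cong) (meson word_equiv.sym word_equiv.trans)
qed

lemma word_class_mult:
  "word_class R u \<otimes>\<^bsub>presented_group R\<^esub> word_class R v = word_class R (u @ v)"
proof -
  have "word_class R (u' @ v') = word_class R (u @ v)"
    if "u' \<in> word_class R u" "v' \<in> word_class R v" for u' v'
    using that unfolding word_class_eq_iff unfolding word_class_def mem_Collect_eq
    by (rule word_equiv.sym[OF word_equiv.append])
  moreover have "u \<in> word_class R u" "v \<in> word_class R v"
    by (simp_all add: word_class_def word_equiv.refl)
  ultimately show ?thesis
    unfolding presented_group_def monoid.simps by blast
qed

lemma word_equiv_inverse:
  "\<exists>v. word_equiv R (v @ u) []"
proof (induction u)
  case Nil
  show ?case by (auto intro: word_equiv.refl exI[of _ "[]"])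
next
  case (Cons x u)
  then obtain v where v: "word_equiv R (v @ u) []" by blast
  obtain g e where x: "x = (g, e)" by (cases x)
  have "word_equiv R [(g, \<not> e), (g, e)] []"
    using word_equiv.cancel[of R g "\<not> e"] by simp
  then have "word_equiv R (v @ [(g, \<not> e), (g, e)] @ u) (v @ [] @ u)"
    by (intro word_equiv.append word_equiv.refl)
  then have "word_equiv R ((v @ [(g, \<not> e)]) @ x # u) []"
    using v x by (simp add: word_equiv.trans[of R _ "v @ u"])
  then show ?case by blast
qed

lemma group_presented_group: "group (presented_group R)"
proof (rule groupI)
  show "\<one>\<^bsub>presented_group R\<^esub> \<in> carrier (presented_group R)"
    by (simp add: presented_group_def)
  fix X assume "X \<in> carrier (presented_group R)"
  then obtain u where X: "X = word_class R u" by (auto simp: presented_group_def)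
  have one: "\<one>\<^bsub>presented_group R\<^esub> = word_class R []"
    by (simp add: presented_group_def)
  show "\<one>\<^bsub>presented_group R\<^esub> \<otimes>\<^bsub>presented_group R\<^esub> X = X"
    by (simp add: X one word_class_mult)
  obtain v where "word_equiv R (v @ u) []" using word_equiv_inverse by blast
  then have "word_class R v \<otimes>\<^bsub>presented_group R\<^esub> X = \<one>\<^bsub>presented_group R\<^esub>"
    by (simp add: X one word_class_mult word_class_eq_iff)
  moreover have "word_class R v \<in> carrier (presented_group R)"
    by (simp add: presented_group_def)
  ultimately show "\<exists>Y\<in>carrier (presented_group R). Y \<otimes>\<^bsub>presented_group R\<^esub> X = \<one>\<^bsub>presented_group R\<^esub>"
    by blast
  fix Y assume "Y \<in> carrier (presented_group R)"
  then obtain v where Y: "Y = word_class R v" by (auto simp: presented_group_def)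
  show "X \<otimes>\<^bsub>presented_group R\<^esub> Y \<in> carrier (presented_group R)"
    unfolding X Y word_class_mult by (simp add: presented_group_def)
  fix Z assume "Z \<in> carrier (presented_group R)"
  then obtain w where Z: "Z = word_class R w" by (auto simp: presented_group_def)
  show "X \<otimes>\<^bsub>presented_group R\<^esub> Y \<otimes>\<^bsub>presented_group R\<^esub> Z =
        X \<otimes>\<^bsub>presented_group R\<^esub> (Y \<otimes>\<^bsub>presented_group R\<^esub> Z)"
    by (simp add: X Y Z word_class_mult)
qed

datatype trefoil_gen = Gen_a | Gen_b

definition trefoil_rels :: "(trefoil_gen word \<times> trefoil_gen word) set" where
  "trefoil_rels = {([(Gen_a, True), (Gen_b, True), (Gen_a, True)],
                    [(Gen_b, True), (Gen_a, True), (Gen_b, True)])}"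

definition trefoil_group :: "trefoil_gen word set monoid" where
  "trefoil_group = presented_group trefoil_rels"

definition trefoil_a :: "trefoil_gen word set" where
  "trefoil_a = word_class trefoil_rels [(Gen_a, True)]"

definition trefoil_b :: "trefoil_gen word set" where
  "trefoil_b = word_class trefoil_rels [(Gen_b, True)]"


section \<open>The real quaternion algebra with $i^2 = -1$, $j^2 = 1$, $ij = -ji$\<close>

text \<open>\<open>Quat t x y z\<close> is \<open>t + x i + y j + z ij\<close>.\<close>

datatype quat = Quat (qre: real) (qi: real) (qj: real) (qk: real)

instantiation quat :: real_algebra_1
begin

definition "0 = Quat 0 0 0 0"
definition "1 = Quat 1 0 0 0"
definition "p + q = Quat (qre p + qre q) (qi p + qi q) (qj p + qj q) (qk p + qk q)"
definition "- p = Quat (- qre p) (- qi p) (- qj p) (- qk p)"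
definition "p - q = Quat (qre p - qre q) (qi p - qi q) (qj p - qj q) (qk p - qk q)"
definition "r *\<^sub>R p = Quat (r * qre p) (r * qi p) (r * qj p) (r * qk p)"
definition "p * q = Quat
  (qre p * qre q - qi p * qi q + qj p * qj q + qk p * qk q)
  (qre p * qi q + qi p * qre q - qj p * qk q + qk p * qj q)
  (qre p * qj q + qj p * qre q - qi p * qk q + qk p * qi q)
  (qre p * qk q + qk p * qre q + qi p * qj q - qj p * qi q)"

instance
  by standard
    (simp_all add: zero_quat_def one_quat_def plus_quat_def uminus_quat_def minus_quat_def
      scaleR_quat_def times_quat_def algebra_simps)

end

lemmas quat_arith = zero_quat_def one_quat_def plus_quat_def uminus_quat_def minus_quat_def
  scaleR_quat_def times_quat_def

definition quat_i :: quat where "quat_i = Quat 0 1 0 0"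
definition quat_j :: quat where "quat_j = Quat 0 0 1 0"

lemma quat_relations:
  "quat_i * quat_i = - 1" "quat_j * quat_j = 1" "quat_i * quat_j = - (quat_j * quat_i)"
  by (simp_all add: quat_i_def quat_j_def quat_arith)

lemma quat_basis:
  "Quat t x y z = t *\<^sub>R 1 + x *\<^sub>R quat_i + y *\<^sub>R quat_j + z *\<^sub>R (quat_i * quat_j)"
  by (simp add: quat_i_def quat_j_def quat_arith)

definition qcnj :: "quat \<Rightarrow> quat" where
  "qcnj p = Quat (qre p) (- qi p) (- qj p) (- qk p)"

definition qnorm :: "quat \<Rightarrow> real" where
  "qnorm p = qre (p * qcnj p)"

lemma qnorm_eq: "qnorm p = (qre p)\<^sup>2 + (qi p)\<^sup>2 - (qj p)\<^sup>2 - (qk p)\<^sup>2"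
  by (simp add: qnorm_def qcnj_def quat_arith power2_eq_square)

lemma mult_qcnj: "p * qcnj p = of_real (qnorm p)" "qcnj p * p = of_real (qnorm p)"
  by (simp_all add: of_real_def qnorm_def qcnj_def quat_arith algebra_simps)

lemma qcnj_mult: "qcnj (p * q) = qcnj q * qcnj p"
  by (simp add: qcnj_def quat_arith algebra_simps)

lemma qnorm_mult: "qnorm (p * q) = qnorm p * qnorm q"
  by (simp add: qnorm_eq quat_arith power2_eq_square algebra_simps)

definition U1 :: "quat monoid" where
  "U1 = \<lparr>carrier = {A. qnorm A = 1}, mult = (*), one = 1\<rparr>"

lemma U1_simps [simp]:
  "A \<in> carrier U1 \<longleftrightarrow> qnorm A = 1" "A \<otimes>\<^bsub>U1\<^esub> B = A * B" "\<one>\<^bsub>U1\<^esub> = 1"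
  by (simp_all add: U1_def)

lemma qnorm_one [simp]: "qnorm 1 = 1" and qnorm_qcnj [simp]: "qnorm (qcnj A) = qnorm A"
  by (simp_all add: qnorm_eq qcnj_def quat_arith)

lemma group_U1: "group U1"
proof (rule groupI)
  fix A assume "A \<in> carrier U1"
  then show "\<exists>B\<in>carrier U1. B \<otimes>\<^bsub>U1\<^esub> A = \<one>\<^bsub>U1\<^esub>"
    by (intro bexI[of _ "qcnj A"]) (auto simp: mult_qcnj)
qed (auto simp: qnorm_mult mult.assoc)

lemma inv_U1: "qnorm A = 1 \<Longrightarrow> inv\<^bsub>U1\<^esub> A = qcnj A"
  by (rule group.inv_equality[OF group_U1]) (auto simp: mult_qcnj)


section \<open>The representation of the trefoil group\<close>

definition word_eval :: "'b monoid \<Rightarrow> ('g \<Rightarrow> 'b) \<Rightarrow> 'g word \<Rightarrow> 'b" where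
  "word_eval G f w =
     foldr (\<lambda>(g, e) x. (if e then f g else inv\<^bsub>G\<^esub> f g) \<otimes>\<^bsub>G\<^esub> x) w \<one>\<^bsub>G\<^esub>"

fun rho1_gen :: "trefoil_gen \<Rightarrow> quat" where
  "rho1_gen Gen_a = 1 + quat_i + quat_j"
| "rho1_gen Gen_b = 1 + (1/4) *\<^sub>R (quat_i - quat_j)"

text \<open>The value does not depend on the representative, see \<open>rho1_word_class\<close>.\<close>

definition rho1 :: "trefoil_gen word set \<Rightarrow> quat" where
  "rho1 X = word_eval U1 rho1_gen (SOME w. w \<in> X)"

lemma rho1_gen_norm: "qnorm (rho1_gen g) = 1"
  by (cases g) (simp_all add: qnorm_eq quat_i_def quat_j_def quat_arith power2_eq_square)

lemma word_eval_closed: "qnorm (word_eval U1 rho1_gen w) = 1"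
  by (induction w) (auto simp: word_eval_def qnorm_mult rho1_gen_norm inv_U1)

lemma word_eval_append:
  "word_eval U1 rho1_gen (u @ v) = word_eval U1 rho1_gen u * word_eval U1 rho1_gen v"
  by (induction u) (auto simp: word_eval_def mult.assoc)

lemma word_eval_equiv:
  "word_equiv trefoil_rels u v \<Longrightarrow> word_eval U1 rho1_gen u = word_eval U1 rho1_gen v"
proof (induction rule: word_equiv.induct)
  case (rel u v)
  then show ?case
    by (simp add: trefoil_rels_def word_eval_def quat_i_def quat_j_def quat_arith)
next
  case (cancel g e)
  then show ?case
    by (simp add: word_eval_def inv_U1 rho1_gen_norm mult_qcnj)
qed (simp_all add: word_eval_append)

lemma rho1_word_class: "rho1 (word_class trefoil_rels w) = word_eval U1 rho1_gen w"
proof -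
  have "w \<in> word_class trefoil_rels w"
    by (simp add: word_class_def word_equiv.refl)
  then have "(SOME v. v \<in> word_class trefoil_rels w) \<in> word_class trefoil_rels w"
    by (rule someI)
  then show ?thesis
    by (simp add: rho1_def word_class_def word_eval_equiv)
qed

lemma rho1_hom: "rho1 \<in> hom trefoil_group U1"
proof (rule homI)
  fix X assume "X \<in> carrier trefoil_group"
  then obtain u where X: "X = word_class trefoil_rels u"
    by (auto simp: trefoil_group_def presented_group_def)
  show "rho1 X \<in> carrier U1"
    by (simp add: X rho1_word_class word_eval_closed)
  fix Y assume "Y \<in> carrier trefoil_group"
  then obtain v where Y: "Y = word_class trefoil_rels v"
    by (auto simp: trefoil_group_def presented_group_def)
  show "rho1 (X \<otimes>\<^bsub>trefoil_group\<^esub> Y) = rho1 X \<otimes>\<^bsub>U1\<^esub> rho1 Y"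
    by (simp add: X Y trefoil_group_def word_class_mult rho1_word_class word_eval_append)
qed

lemma rho1_generators:
  "rho1 trefoil_a = 1 + quat_i + quat_j"
  "rho1 trefoil_b = 1 + (1/4) *\<^sub>R (quat_i - quat_j)"
  by (simp_all add: trefoil_a_def trefoil_b_def rho1_word_class word_eval_def)


section \<open>Minkowski space and its isometries\<close>

text \<open>The space of pure quaternions is identified with \<open>real^3\<close> via the basis \<open>i, j, ij\<close>.\<close>

definition pure :: "real^3 \<Rightarrow> quat" where
  "pure v = Quat 0 (v$1) (v$2) (v$3)"

definition vpart :: "quat \<Rightarrow> real^3" where
  "vpart p = vector [qi p, qj p, qk p]"

definition mink_form :: "real^3 \<Rightarrow> real^3 \<Rightarrow> real" where
  "mink_form v w = (qnorm (pure (v + w)) - qnorm (pure v) - qnorm (pure w)) / 2"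

lemma mink_form_eq: "mink_form v w = v$1 * w$1 - v$2 * w$2 - v$3 * w$3"
  by (simp add: mink_form_def qnorm_eq pure_def power2_eq_square field_simps)

lemma mink_form_self: "mink_form v v = qnorm (pure v)"
  by (simp add: mink_form_eq qnorm_eq pure_def power2_eq_square)

definition SO12_set :: "(real^3^3) set" where
  "SO12_set = {M. (\<forall>v. qnorm (pure (M *v v)) = qnorm (pure v)) \<and> det M = 1}"

definition SO12_0 :: "(real^3^3) monoid" where
  "SO12_0 = \<lparr>carrier = connected_component_set SO12_set (mat 1), mult = (**), one = mat 1\<rparr>"

definition c_map :: "quat \<Rightarrow> real^3^3" where
  "c_map A = matrix (\<lambda>v. vpart (A * pure v * qcnj A))"

lemma pure_c_map: "pure (c_map A *v v) = A * pure v * qcnj A"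
proof -
  have "linear (\<lambda>v. vpart (A * pure v * qcnj A))"
    by (rule linearI)
      (simp_all add: vpart_def pure_def qcnj_def quat_arith vec_eq_iff forall_3 algebra_simps)
  then have "c_map A *v v = vpart (A * pure v * qcnj A)"
    unfolding c_map_def by (simp add: matrix_works)
  then show ?thesis
    by (simp add: vpart_def pure_def qcnj_def quat_arith algebra_simps)
qed

lemma pure_inject: "pure v = pure w \<longleftrightarrow> v = w"
  by (auto simp: pure_def vec_eq_iff forall_3)

lemma c_map_one: "c_map 1 = mat 1"
proof -
  have "c_map 1 *v v = mat 1 *v v" for v
    by (subst pure_inject[symmetric], subst pure_c_map) (simp add: qcnj_def quat_arith pure_def)
  then show ?thesis by (metis matrix_eq)
qed

lemma c_map_mult: "c_map (A * B) = c_map A ** c_map B"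
proof -
  have "c_map (A * B) *v v = (c_map A ** c_map B) *v v" for v
    by (simp add: pure_inject[symmetric] pure_c_map qcnj_mult mult.assoc
        flip: matrix_vector_mul_assoc)
  then show ?thesis by (metis matrix_eq)
qed


lemma c_map_explicit:
  "c_map (Quat t x y z) = vector
    [vector [t\<^sup>2 + x\<^sup>2 + y\<^sup>2 + z\<^sup>2, 2 * t * z - 2 * x * y, - 2 * t * y - 2 * x * z],
     vector [2 * x * y + 2 * t * z, t\<^sup>2 - x\<^sup>2 - y\<^sup>2 + z\<^sup>2, - 2 * t * x - 2 * y * z],
     vector [2 * x * z - 2 * t * y, 2 * t * x - 2 * y * z, t\<^sup>2 - x\<^sup>2 + y\<^sup>2 - z\<^sup>2]]"
  by (simp add: c_map_def matrix_def vec_eq_iff forall_3 vpart_def pure_def qcnj_def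
      quat_arith axis_def power2_eq_square)

lemma det_c_map: "det (c_map A) = (qnorm A) ^ 3"
proof (cases A)
  case (Quat t x y z)
  show ?thesis
    unfolding Quat c_map_explicit det_3 qnorm_eq
    by simp algebra
qed

lemma connected_U1_image: "connected (c_map ` carrier U1)"
proof -
  define h :: "real \<times> real \<times> real \<Rightarrow> quat" where
    "h = (\<lambda>(s, y, z). Quat (sqrt (1 + y\<^sup>2 + z\<^sup>2) * cos s) (sqrt (1 + y\<^sup>2 + z\<^sup>2) * sin s) y z)"
  have pos: "1 + y\<^sup>2 + z\<^sup>2 > 0" for y z :: real
    by (simp add: add_pos_nonneg)
  have "carrier U1 = range h"
  proof (intro equalityI subsetI)
    fix A assume "A \<in> carrier U1"
    then have A: "(qre A)\<^sup>2 + (qi A)\<^sup>2 = 1 + (qj A)\<^sup>2 + (qk A)\<^sup>2"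
      by (simp add: qnorm_eq)
    define r where "r = sqrt (1 + (qj A)\<^sup>2 + (qk A)\<^sup>2)"
    have r: "r > 0" "r\<^sup>2 = 1 + (qj A)\<^sup>2 + (qk A)\<^sup>2"
      using pos[of "qj A" "qk A"] by (simp_all add: r_def)
    have "(qre A / r)\<^sup>2 + (qi A / r)\<^sup>2 = ((qre A)\<^sup>2 + (qi A)\<^sup>2) / r\<^sup>2"
      by (simp add: power_divide add_divide_distrib)
    also have "\<dots> = 1" using r(1) by (simp only: A r(2)[symmetric]) simp
    finally obtain s where s: "qre A / r = cos s" "qi A / r = sin s"
      using sincos_total_2pi by metis
    then have "qre A = r * cos s" "qi A = r * sin s"
      using r(1) by (simp_all add: field_simps)
    then have "h (s, qj A, qk A) = Quat (qre A) (qi A) (qj A) (qk A)"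
      by (simp add: h_def r_def)
    then have "A = h (s, qj A, qk A)" by simp
    then show "A \<in> range h" by blast
  next
    fix A assume "A \<in> range h"
    then obtain s y z where A: "A = h (s, y, z)" by auto
    have "qnorm A = (sqrt (1 + y\<^sup>2 + z\<^sup>2))\<^sup>2 * ((cos s)\<^sup>2 + (sin s)\<^sup>2) - y\<^sup>2 - z\<^sup>2"
      by (simp add: A h_def qnorm_eq power_mult_distrib distrib_left del: sin_cos_squared_add2)
    then show "A \<in> carrier U1"
      using pos[of y z] by simp
  qed
  moreover have "continuous_on UNIV (\<lambda>p. c_map (h p))"
  proof -
    have "continuous_on UNIV (\<lambda>p. \<chi> i j. c_map (h p) $ i $ j)"
    proof (intro continuous_on_vec_lambda)
      fix i j :: 3
      have "\<forall>i j. continuous_on UNIV (\<lambda>p. c_map (h p) $ i $ j)"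
        unfolding h_def case_prod_beta c_map_explicit forall_3 vector_3
        by (intro conjI continuous_intros)
      then show "continuous_on UNIV (\<lambda>p. c_map (h p) $ i $ j)"
        by blast
    qed
    then show ?thesis by simp
  qed
  ultimately show ?thesis
    by (metis connected_UNIV connected_continuous_image image_image)
qed

lemma c_map_in_SO12: "qnorm A = 1 \<Longrightarrow> c_map A \<in> SO12_set"
  by (simp add: SO12_set_def pure_c_map det_c_map qnorm_mult)

lemma c_map_hom: "c_map \<in> hom U1 SO12_0"
proof (rule homI)
  fix A assume A: "A \<in> carrier U1"
  have "mat 1 \<in> c_map ` carrier U1"
    by (metis U1_simps(1) c_map_one image_eqI qnorm_one)
  moreover have "c_map ` carrier U1 \<subseteq> SO12_set"
    by (auto simp: c_map_in_SO12)
  ultimately have "c_map ` carrier U1 \<subseteq> carrier SO12_0"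
    unfolding SO12_0_def monoid.simps partial_object.simps
    by (intro connected_component_maximal connected_U1_image)
  then show "c_map A \<in> carrier SO12_0"
    using A by blast
next
  fix A B
  show "c_map (A \<otimes>\<^bsub>U1\<^esub> B) = c_map A \<otimes>\<^bsub>SO12_0\<^esub> c_map B"
    by (simp add: SO12_0_def c_map_mult)
qed

lemma SO12_set_mult: "M \<in> SO12_set \<Longrightarrow> N \<in> SO12_set \<Longrightarrow> M ** N \<in> SO12_set"
  by (simp add: SO12_set_def det_mul flip: matrix_vector_mul_assoc)

lemma SO12_set_inverse:
  assumes "M \<in> SO12_set"
  obtains N where "N \<in> SO12_set" "N ** M = mat 1" "M ** N = mat 1"
proof -
  have "invertible M"
    using assms by (simp add: SO12_set_def invertible_det_nz)
  then obtain N where N: "N ** M = mat 1" "M ** N = mat 1"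
    by (auto simp: invertible_def)
  have "det N * det M = 1" by (metis N(1) det_mul det_I)
  then have "det N = 1" using assms by (simp add: SO12_set_def)
  moreover have "qnorm (pure (N *v v)) = qnorm (pure v)" for v
  proof -
    have "qnorm (pure (N *v v)) = qnorm (pure (M *v (N *v v)))"
      using assms by (simp add: SO12_set_def)
    then show ?thesis by (simp add: matrix_vector_mul_assoc N)
  qed
  ultimately have "N \<in> SO12_set" by (simp add: SO12_set_def)
  then show ?thesis using that N by blast
qed

lemma group_SO12_0: "group SO12_0"
proof -
  let ?C = "connected_component_set SO12_set (mat 1)"
  have one_SO: "mat 1 \<in> SO12_set" by (simp add: SO12_set_def)
  then have one: "mat 1 \<in> ?C" by (simp add: connected_component_refl)
  have sub: "?C \<subseteq> SO12_set" by (rule connected_component_subset)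
  have conn: "connected ((**) M ` ?C)" for M :: "real^3^3"
  proof (rule connected_continuous_image)
    show "continuous_on ?C ((**) M)"
      unfolding matrix_matrix_mult_def
      by (intro continuous_on_vec_lambda continuous_intros)
    show "connected ?C" by simp
  qed
  have img: "(**) M ` ?C \<subseteq> SO12_set" if "M \<in> SO12_set" for M
    using that sub SO12_set_mult by blast
  have mult: "M ** N \<in> ?C" if M: "M \<in> ?C" and N: "N \<in> ?C" for M N
  proof -
    have "M ** mat 1 \<in> (**) M ` ?C" using one by (rule imageI)
    then have "M \<in> (**) M ` ?C" by simp
    then have "(**) M ` ?C \<subseteq> connected_component_set SO12_set M"
      using conn img M sub by (intro connected_component_maximal) blast+
    moreover have "connected_component_set SO12_set M = ?C"
      using M connected_component_eq by blast
    ultimately show ?thesis using N by blast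
  qed
  have inv: "\<exists>N\<in>?C. N ** M = mat 1" if M: "M \<in> ?C" for M
  proof -
    obtain N where N: "N \<in> SO12_set" "N ** M = mat 1" "M ** N = mat 1"
      using SO12_set_inverse M sub by blast
    have "N ** M \<in> (**) N ` ?C" using M by (rule imageI)
    then have "mat 1 \<in> (**) N ` ?C" using N by simp
    then have "(**) N ` ?C \<subseteq> ?C"
      by (intro connected_component_maximal conn img[OF N(1)])
    moreover have "N ** mat 1 \<in> (**) N ` ?C" using one by (rule imageI)
    ultimately have "N \<in> ?C" by auto
    then show ?thesis using N by blast
  qed
  show ?thesis
  proof (rule groupI)
    fix M assume "M \<in> carrier SO12_0"
    then show "\<exists>N\<in>carrier SO12_0. N \<otimes>\<^bsub>SO12_0\<^esub> M = \<one>\<^bsub>SO12_0\<^esub>"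
      using inv unfolding SO12_0_def monoid.simps partial_object.simps by blast
  next
    fix M N assume "M \<in> carrier SO12_0" "N \<in> carrier SO12_0"
    then show "M \<otimes>\<^bsub>SO12_0\<^esub> N \<in> carrier SO12_0"
      using mult unfolding SO12_0_def monoid.simps partial_object.simps by blast
  next
    show "\<one>\<^bsub>SO12_0\<^esub> \<in> carrier SO12_0"
      using one unfolding SO12_0_def monoid.simps partial_object.simps by blast
  qed (simp_all add: SO12_0_def matrix_mul_assoc)
qed


section \<open>The hyperbolic plane and hyperbolic cone orbifolds\<close>

definition hyp_plane :: "(real^3) set" where
  "hyp_plane = {v. mink_form v v = 1 \<and> v$1 > 0}"

definition hyp_dist :: "real^3 \<Rightarrow> real^3 \<Rightarrow> real" where
  "hyp_dist v w = arcosh (mink_form v w)"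

text \<open>
  The metric induced on the hyperboloid, written as the graph \<open>x = sqrt (1 + y\<^sup>2 + z\<^sup>2)\<close>, has area
  element \<open>dy dz / sqrt (1 + y\<^sup>2 + z\<^sup>2)\<close>.
\<close>

definition hyp_area :: "(real^3) set \<Rightarrow> ennreal" where
  "hyp_area D = (\<integral>\<^sup>+ (y, z). indicator D (vector [sqrt (1 + y\<^sup>2 + z\<^sup>2), y, z]) *
                    ennreal (1 / sqrt (1 + y\<^sup>2 + z\<^sup>2)) \<partial>(lborel :: (real \<times> real) measure))"

definition properly_discontinuous :: "(real^3^3) set \<Rightarrow> bool" where
  "properly_discontinuous \<Gamma> \<longleftrightarrow>
     (\<forall>K. compact K \<and> K \<subseteq> hyp_plane \<longrightarrow> finite {M\<in>\<Gamma>. (\<lambda>v. M *v v) ` K \<inter> K \<noteq> {}})"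

text \<open>The quotient of the hyperbolic plane has finite area iff a Borel set of finite area meets every orbit.\<close>

definition finite_coarea :: "(real^3^3) set \<Rightarrow> bool" where
  "finite_coarea \<Gamma> \<longleftrightarrow>
     (\<exists>D \<in> sets borel. D \<subseteq> hyp_plane \<and> hyp_area D < \<infinity> \<and>
        (\<forall>p\<in>hyp_plane. \<exists>M\<in>\<Gamma>. M *v p \<in> D))"

text \<open>
  A cone orbifold is given by its underlying space \<open>X\<close> and the order \<open>m x\<close> of the local group at each
  point \<open>x\<close> (so \<open>m x = 1\<close> at regular points, and \<open>m x\<close> is the order of the cone point otherwise).
  The quotient of the hyperbolic plane by a properly discontinuous group of orientation preserving
  isometries is this orbifold if \<open>X\<close> is the topological quotient and the local groups are the point
  stabilizers. The latter, being finite groups of orientation preserving isometries fixing a point,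
  are automatically cyclic groups of rotations.
\<close>

definition quotient_is_cone_orbifold ::
  "(real^3^3) set \<Rightarrow> 'a topology \<Rightarrow> ('a \<Rightarrow> nat) \<Rightarrow> bool" where
  "quotient_is_cone_orbifold \<Gamma> X m \<longleftrightarrow>
     (\<exists>q. quotient_map (top_of_set hyp_plane) X q \<and>
          (\<forall>u\<in>hyp_plane. \<forall>v\<in>hyp_plane. q u = q v \<longleftrightarrow> (\<exists>M\<in>\<Gamma>. M *v u = v)) \<and>
          (\<forall>u\<in>hyp_plane. finite {M\<in>\<Gamma>. M *v u = u} \<and> card {M\<in>\<Gamma>. M *v u = u} = m (q u)))"

text \<open>
  \<open>\<Gamma>\<close> is the image of the holonomy of a complete hyperbolic structure of finite area on the once-punctured
  2-sphere with two cone points, of orders 2 and 3. The quotient of the hyperbolic plane by a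
  properly discontinuous group is always complete, and finite area makes the puncture a cusp.
\<close>

definition holonomy_group_of_S2_2_3_inf :: "(real^3^3) set \<Rightarrow> bool" where
  "holonomy_group_of_S2_2_3_inf \<Gamma> \<longleftrightarrow>
     subgroup \<Gamma> SO12_0 \<and> properly_discontinuous \<Gamma> \<and> finite_coarea \<Gamma> \<and>
     (\<exists>n p2 p3 :: real^3.
        {n, p2, p3} \<subseteq> sphere 0 1 \<and> n \<noteq> p2 \<and> n \<noteq> p3 \<and> p2 \<noteq> p3 \<and>
        quotient_is_cone_orbifold \<Gamma> (top_of_set (sphere 0 1 - {n}))
          (\<lambda>x. if x = p2 then 2 else if x = p3 then 3 else 1))"


section \<open>The modular group\<close>

definition upper_half_plane :: "complex set" where
  "upper_half_plane = {z. Im z > 0}"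

definition uhp_dist :: "complex \<Rightarrow> complex \<Rightarrow> real" where
  "uhp_dist z w = arcosh (1 + (cmod (z - w))\<^sup>2 / (2 * Im z * Im w))"

definition modular_group :: "(complex \<Rightarrow> complex) set" where
  "modular_group =
     {restrict (\<lambda>z. (of_int a * z + of_int b) / (of_int c * z + of_int d)) upper_half_plane
      | a b c d :: int. a * d - b * c = 1}"

definition conjugate_to_modular_group :: "(real^3^3) set \<Rightarrow> bool" where
  "conjugate_to_modular_group \<Gamma> \<longleftrightarrow>
     (\<exists>\<phi>. bij_betw \<phi> hyp_plane upper_half_plane \<and>
          (\<forall>u\<in>hyp_plane. \<forall>v\<in>hyp_plane. uhp_dist (\<phi> u) (\<phi> v) = hyp_dist u v) \<and>
          (\<lambda>M. restrict (\<lambda>z. \<phi> (M *v the_inv_into hyp_plane \<phi> z)) upper_half_plane) ` \<Gamma>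
            = modular_group)"

end

theory Submission
  imports Defs
begin

text \<open>
  In the model of the quaternion algebra by real matrices the images of the two generators are
  conjugate, by a diagonal matrix, to \<open>[[1,1],[0,1]]\<close> and \<open>[[1,0],[-1,1]]\<close>, which generate
  \<open>SL(2,Z)\<close> by the Euclidean algorithm. Sending a point of the hyperboloid to (half of) the fixed point
  of the corresponding traceless matrix is an isometry onto the upper half plane that turns the
  action into the one by Moebius transformations. The quotient is found without modular
  functions: on the standard fundamental domain the coordinates \<open>(Re z, |z|^2 - 1)\<close> straighten it to a
  half strip, and \<open>cos (2 \<pi> (Re z + i (|z|^2 - 1)))\<close> realizes exactly the boundary identifications. Since
  the translates of the fundamental domain are locally finite, this map extends to a continuous
  invariant map onto the complex plane, that is, onto a punctured sphere.
\<close>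

section \<open>Integer matrices and the hyperboloid chart\<close>

text \<open>Both boundary identifications of the fundamental domain are restrictions of one
  reflection, \<open>- cnj z\<close>: it equals z - 1 or z + 1 on the vertical sides and -1/z on the
  unit arc. It keeps |z| and reverses Re z. This dictates the coordinate |z|^2 - 1, which is
  invariant under the reflection and, unlike Im z, constant on the arc, where it vanishes. The
  equation cos (2 pi w) = cos (2 pi w') means w' = w + n or w' = - w + n; in the half strip the
  second is possible only at height 0, so interior points are never glued. The critical values 1 and
  -1 of the cosine are taken at i and at the two lower corners and become the cone points. An
  explicit non-holomorphic map is enough because the quotient is required as a topological space
  with stabilizer orders.

  The factor 2 in the quaternion matrices and the factor 1/2 in the chart have one origin:
  conjugation by diag (sqrt 2, 1 / sqrt 2), which scales the upper half plane by 2. Since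
  \<open>c_map\<close> sends A and -A to the same isometry, stabilizers must be counted as
  isometries, not as integer matrices.\<close>

type_synonym imat = "int \<times> int \<times> int \<times> int"

definition SL2Z :: "imat set" where
  "SL2Z = {(a, b, c, d). a * d - b * c = 1}"

fun imat_mult :: "imat \<Rightarrow> imat \<Rightarrow> imat" where
  "imat_mult (a, b, c, d) (a', b', c', d') =
     (a * a' + b * c', a * b' + b * d', c * a' + d * c', c * b' + d * d')"

fun imat_adj :: "imat \<Rightarrow> imat" where
  "imat_adj (a, b, c, d) = (d, - b, - c, a)"

fun mob :: "imat \<Rightarrow> complex \<Rightarrow> complex" where
  "mob (a, b, c, d) z = (of_int a * z + of_int b) / (of_int c * z + of_int d)"

text \<open>In the real matrix model \<open>i \<mapsto> [[0,1],[-1,0]]\<close>, \<open>j \<mapsto> [[0,1],[1,0]]\<close> of the quaternion algebra this is the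
  matrix \<open>[[a, 2b], [c/2, d]]\<close>; both generators of the trefoil group have this shape.\<close>

fun modular_quat :: "imat \<Rightarrow> quat" where
  "modular_quat (a, b, c, d) =
     Quat (of_int (a + d) / 2) (of_int b - of_int c / 4) (of_int b + of_int c / 4) (of_int (a - d) / 2)"

abbreviation modular_isom :: "imat \<Rightarrow> real^3^3" where
  "modular_isom g \<equiv> c_map (modular_quat g)"

lemma SL2Z_iff [simp]: "(a, b, c, d) \<in> SL2Z \<longleftrightarrow> a * d - b * c = 1"
  by (simp add: SL2Z_def)

lemma imat_mult_SL2Z [simp]: "g \<in> SL2Z \<Longrightarrow> h \<in> SL2Z \<Longrightarrow> imat_mult g h \<in> SL2Z"
proof (cases g; cases h)
  fix a b c d a' b' c' d'
  assume gh: "g \<in> SL2Z" "h \<in> SL2Z" "g = (a, b, c, d)" "h = (a', b', c', d')"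
  have "(a * a' + b * c') * (c * b' + d * d') - (a * b' + b * d') * (c * a' + d * c') =
      (a * d - b * c) * (a' * d' - b' * c')"
    by algebra
  also have "\<dots> = 1" using gh by simp
  finally show ?thesis using gh by simp
qed

lemma imat_adj_SL2Z [simp]: "g \<in> SL2Z \<Longrightarrow> imat_adj g \<in> SL2Z"
  by (cases g) (simp add: mult.commute)

lemma imat_adj_mult: "g \<in> SL2Z \<Longrightarrow> imat_mult (imat_adj g) g = (1, 0, 0, 1)"
  by (cases g) (simp add: algebra_simps)

lemma imat_mult_adj: "g \<in> SL2Z \<Longrightarrow> imat_mult g (imat_adj g) = (1, 0, 0, 1)"
  by (cases g) (simp add: algebra_simps)

lemma imat_adj_adj [simp]: "imat_adj (imat_adj g) = g"
  by (cases g) simp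

lemma modular_quat_mult: "modular_quat (imat_mult g h) = modular_quat g * modular_quat h"
  by (cases g; cases h) (simp add: times_quat_def field_simps)

lemma modular_quat_one: "modular_quat (1, 0, 0, 1) = 1"
  by (simp add: one_quat_def)

lemma qnorm_modular_quat: "g \<in> SL2Z \<Longrightarrow> qnorm (modular_quat g) = 1"
proof (cases g)
  case (fields a b c d)
  assume "g \<in> SL2Z"
  then have "real_of_int (a * d - b * c) = 1" by (simp add: fields)
  then show ?thesis
    by (simp add: fields qnorm_eq power2_eq_square field_simps)
qed

lemma modular_quat_inverse: "g \<in> SL2Z \<Longrightarrow> modular_quat (imat_adj g) = qcnj (modular_quat g)"
  by (cases g) (simp add: qcnj_def field_simps)

section \<open>Moebius transformations of the upper half plane\<close>

lemma in_uhp [simp]: "z \<in> upper_half_plane \<longleftrightarrow> Im z > 0"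
  by (simp add: upper_half_plane_def)

lemma mob_denom_nz:
  assumes "Im z > 0" "a * d - b * c = (1::int)"
  shows "of_int c * z + of_int d \<noteq> (0::complex)"
proof
  assume *: "of_int c * z + of_int d = 0"
  then have "of_int c * Im z = 0" 
    by (auto simp: complex_eq_iff)
  with * assms show False by (auto simp: complex_eq_iff)
qed

lemma Im_mob:
  assumes "Im z > 0" "(a, b, c, d) \<in> SL2Z"
  shows "Im (mob (a, b, c, d) z) = Im z / (cmod (of_int c * z + of_int d))\<^sup>2"
proof -
  have "real_of_int (a * d - b * c) = 1" using assms by simp
  then have "(of_int a * Im z) * (of_int c * Re z + of_int d) - (of_int a * Re z + of_int b) * (of_int c * Im z) = Im z"
    by simp algebra
  then show ?thesis
    by (simp add: Im_divide cmod_power2)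
qed

lemma Im_mob_pos: "Im z > 0 \<Longrightarrow> g \<in> SL2Z \<Longrightarrow> Im (mob g z) > 0"
  by (cases g) (auto simp: Im_mob mob_denom_nz simp del: mob.simps)

lemma mob_mult:
  assumes "Im z > 0" "g \<in> SL2Z" "h \<in> SL2Z"
  shows "mob (imat_mult g h) z = mob g (mob h z)"
proof (cases g; cases h)
  fix a b c d a' b' c' d'
  assume gh: "g = (a, b, c, d)" "h = (a', b', c', d')"
  have "of_int c' * z + of_int d' \<noteq> 0"
    using assms gh mob_denom_nz by auto
  then show ?thesis
    by (simp add: gh divide_simps) (simp add: algebra_simps)
qed

lemma mob_one [simp]: "mob (1, 0, 0, 1) z = z"
  by simp

lemma mob_adj: "Im z > 0 \<Longrightarrow> g \<in> SL2Z \<Longrightarrow> mob (imat_adj g) (mob g z) = z"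
  by (metis imat_adj_SL2Z imat_adj_mult mob_mult mob_one)

section \<open>The chart from the hyperboloid to the upper half plane\<close>

text \<open>The point \<open>hyp_chart v\<close> is half of the fixed point in the upper half plane of the traceless matrix \<open>pure v\<close>.\<close>

definition hyp_chart :: "real^3 \<Rightarrow> complex" where
  "hyp_chart v = Complex (- v$3 / (2 * (v$1 - v$2))) (1 / (2 * (v$1 - v$2)))"

definition hyp_chart_inv :: "complex \<Rightarrow> real^3" where
  "hyp_chart_inv w =
     vector [(cmod w)\<^sup>2 / Im w + 1 / (4 * Im w), (cmod w)\<^sup>2 / Im w - 1 / (4 * Im w), - Re w / Im w]"

text \<open>In the light-cone coordinates v1 - v2 and v1 + v2 the form is a product minus a square.
  The product is positive on the hyperboloid, so both factors have the same sign and v1 - v2, the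
  denominator of the chart, can replace v1 in the choice of the sheet.\<close>

lemma hyp_plane_iff: "v \<in> hyp_plane \<longleftrightarrow> v$1 - v$2 > 0 \<and> (v$1 - v$2) * (v$1 + v$2) = 1 + (v$3)\<^sup>2"
proof -
  have "v$1 > 0 \<longleftrightarrow> v$1 - v$2 > 0" if "(v$1 - v$2) * (v$1 + v$2) = 1 + (v$3)\<^sup>2"
  proof -
    have "(v$1 - v$2) * (v$1 + v$2) > 0" by (simp add: that add_pos_nonneg)
    then show ?thesis by (auto simp: zero_less_mult_iff)
  qed
  then show ?thesis
    by (auto simp: hyp_plane_def mink_form_eq power2_eq_square algebra_simps)
qed

lemma hyp_chart_pos: "v \<in> hyp_plane \<Longrightarrow> Im (hyp_chart v) > 0"
  by (simp add: hyp_chart_def hyp_plane_iff)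

lemma hyp_chart_inv_in: "Im w > 0 \<Longrightarrow> hyp_chart_inv w \<in> hyp_plane"
  unfolding hyp_plane_iff hyp_chart_inv_def cmod_power2
  by (simp add: divide_simps) (simp add: power2_eq_square algebra_simps)

lemma hyp_chart_chart_inv: "Im w > 0 \<Longrightarrow> hyp_chart (hyp_chart_inv w) = w"
  by (simp add: hyp_chart_def hyp_chart_inv_def complex_eq_iff field_simps)

lemma hyp_chart_inv_chart:
  assumes "v \<in> hyp_plane" shows "hyp_chart_inv (hyp_chart v) = v"
proof -
  have u: "v$1 - v$2 > 0" and s: "v$1 + v$2 = (1 + (v$3)\<^sup>2) / (v$1 - v$2)"
    using assms by (auto simp: hyp_plane_iff field_simps)
  have *: "(cmod (hyp_chart v))\<^sup>2 / Im (hyp_chart v) = (v$1 + v$2) / 2"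
    using u unfolding s hyp_chart_def cmod_power2
    by (simp add: divide_simps) (simp add: power2_eq_square algebra_simps)
  show ?thesis
    using u unfolding hyp_chart_inv_def * by (simp add: hyp_chart_def vec_eq_iff forall_3 field_simps)
qed

lemma hyp_chart_bij: "bij_betw hyp_chart hyp_plane upper_half_plane"
  by (rule bij_betwI[where g = hyp_chart_inv])
    (auto simp: hyp_chart_pos hyp_chart_inv_in hyp_chart_chart_inv hyp_chart_inv_chart)

lemma uhp_dist_hyp_chart:
  assumes "u \<in> hyp_plane" "v \<in> hyp_plane"
  shows "uhp_dist (hyp_chart u) (hyp_chart v) = hyp_dist u v"
proof -
  have u: "u$1 - u$2 > 0" "u$1 + u$2 = (1 + (u$3)\<^sup>2) / (u$1 - u$2)"
    using assms by (auto simp: hyp_plane_iff field_simps)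
  have v: "v$1 - v$2 > 0" "v$1 + v$2 = (1 + (v$3)\<^sup>2) / (v$1 - v$2)"
    using assms by (auto simp: hyp_plane_iff field_simps)
  have "mink_form u v = ((u$1 - u$2) * (v$1 + v$2) + (u$1 + u$2) * (v$1 - v$2)) / 2 - u$3 * v$3"
    by (simp add: mink_form_eq field_simps)
  also have "\<dots> = 1 + (cmod (hyp_chart u - hyp_chart v))\<^sup>2 / (2 * Im (hyp_chart u) * Im (hyp_chart v))"
    using u(1) v(1) unfolding u(2) v(2) hyp_chart_def cmod_power2
    by (simp add: divide_simps) (simp add: power2_eq_square algebra_simps)
  finally show ?thesis by (simp add: uhp_dist_def hyp_dist_def)
qed

text \<open>\<open>c_map\<close> acts on \<open>pure v\<close> by conjugation, and conjugating a
  traceless matrix moves its fixed point by the Moebius map. The verification uses light-cone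
  coordinates, where the new coordinates are explicit linear forms in the old ones.\<close>

lemma modular_isom_hyp_plane_chart:
  assumes "v \<in> hyp_plane" "g \<in> SL2Z"
  shows "modular_isom g *v v \<in> hyp_plane \<and> hyp_chart (modular_isom g *v v) = mob g (hyp_chart v)"
proof (cases g)
  case (fields a b c d)
  define A B C D where "A = real_of_int a" "B = real_of_int b" "C = real_of_int c" "D = real_of_int d"
  have "real_of_int (a * d - b * c) = 1" using assms(2) by (simp add: fields)
  then have det: "A * D - B * C = 1" by (simp add: A_B_C_D_def)
  define v' where "v' = modular_isom g *v v"
  define s u z s' u' z' where suz: "s = v$1 + v$2" "u = v$1 - v$2" "z = v$3"
    "s' = v'$1 + v'$2" "u' = v'$1 - v'$2" "z' = v'$3"
  have pv: "pure v' = modular_quat g * pure v * qcnj (modular_quat g)"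
    unfolding v'_def by (rule pure_c_map)
  have v1: "v$1 = (s + u) / 2" "v$2 = (s - u) / 2" by (simp_all add: suz)
  have comps: "v'$1 = qi (pure v')" "v'$2 = qj (pure v')" "v'$3 = qk (pure v')"
    by (simp_all add: pure_def)
  have u': "u' = D\<^sup>2 * u - C * D * z + C\<^sup>2 * s / 4"
    and z': "z' = A * D * z - 2 * B * D * u - A * C * s / 2 + B * C * z"
    and s': "s' = 4 * B\<^sup>2 * u - 4 * A * B * z + A\<^sup>2 * s"
    unfolding suz(4-6) comps pv 
    by (simp_all add: fields pure_def qcnj_def times_quat_def v1 suz(3)[symmetric]
        flip: A_B_C_D_def) (simp_all add: power2_eq_square field_simps)
  have us: "u > 0" "s = (1 + z\<^sup>2) / u"
    using assms(1) by (auto simp: hyp_plane_iff suz field_simps)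
  have "u * s = 1 + z\<^sup>2" using us by simp
  then have us1: "u * s - z\<^sup>2 = 1" by simp
  have "u' * s' - z'\<^sup>2 = (A * D - B * C)\<^sup>2 * (u * s - z\<^sup>2)"
    unfolding u' z' s' by (simp add: power2_eq_square field_simps)
  then have inv: "u' * s' = 1 + z'\<^sup>2" by (simp add: det us1)
  \<comment> \<open>Completing the square gives u' > 0, so the sheet is preserved. This is
    \<open>Im_mob\<close> in disguise: u' / u is |c w + d|^2 for the chart value w of v.\<close>
  have "4 * u * u' = (2 * D * u - C * z)\<^sup>2 + C\<^sup>2 * (u * s - z\<^sup>2)"
    unfolding u' by (simp add: power2_eq_square field_simps)
  then have "4 * u * u' = (2 * D * u - C * z)\<^sup>2 + C\<^sup>2"
    by (simp add: us1)
  moreover have "(2 * D * u - C * z)\<^sup>2 + C\<^sup>2 > 0"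
  proof (cases "C = 0")
    case True
    then show ?thesis using det us by auto
  qed (simp add: add_nonneg_pos)
  ultimately have "4 * u * u' > 0" by simp
  then have "u' > 0" using us by (simp add: zero_less_mult_iff)
  have "v' \<in> hyp_plane"
    using \<open>u' > 0\<close> inv by (simp add: hyp_plane_iff suz)
  have w: "hyp_chart v = Complex (- z / (2 * u)) (1 / (2 * u))"
    "hyp_chart v' = Complex (- z' / (2 * u')) (1 / (2 * u'))"
    by (simp_all add: hyp_chart_def suz)
  have nz: "of_int c * hyp_chart v + of_int d \<noteq> 0"
    using mob_denom_nz[OF hyp_chart_pos[OF assms(1)], of a d b c] assms(2) fields by simp
  have "hyp_chart v' * (of_int c * hyp_chart v + of_int d) = of_int a * hyp_chart v + of_int b"
  proof -
    have "2 * u' * A + z' * C = (A * D - B * C) * (2 * D * u - C * z)"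
      "D * z' + 2 * u' * B = (A * D - B * C) * (D * z - C * s / 2)"
      unfolding u' z' by (simp_all add: power2_eq_square field_simps)
    then have e: "2 * u' * A + z' * C = 2 * D * u - C * z" "D * z' + 2 * u' * B = D * z - C * s / 2"
      by (simp_all add: det)
    have "z' * (C * z - 2 * u * D) - C - 2 * u' * (2 * u * B - A * z)
        = z * (2 * u' * A + z' * C) - 2 * u * (D * z' + 2 * u' * B) - C"
      by (simp add: algebra_simps)
    also have "\<dots> = C * (u * s - z\<^sup>2) - C"
      unfolding e by (simp add: power2_eq_square algebra_simps)
    finally have re: "z' * (C * z - 2 * u * D) - C = 2 * u' * (2 * u * B - A * z)"
      by (simp add: us1)
    \<comment> \<open>With the denominators 2 u and 2 u' cleared, \<open>re\<close> is the real part
      of the Moebius equation and \<open>e(1)\<close> its imaginary part.\<close>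
    have "(4 * u * u') *\<^sub>R (hyp_chart v' * (of_int c * hyp_chart v + of_int d)) =
        (4 * u * u') *\<^sub>R (of_int a * hyp_chart v + of_int b)"
      unfolding w complex_eq_iff using \<open>u > 0\<close> \<open>u' > 0\<close> re e(1)
      by (simp add: field_simps flip: A_B_C_D_def) (intro conjI; algebra)
    then show ?thesis using \<open>u > 0\<close> \<open>u' > 0\<close> by simp
  qed
  then have "hyp_chart v' = mob g (hyp_chart v)"
    using nz by (simp add: fields field_simps)
  with \<open>v' \<in> hyp_plane\<close> show ?thesis by (simp add: v'_def)
qed

section \<open>The image of the representation\<close>

lemma rho1_image_eq_range: "rho1 ` carrier trefoil_group = range (word_eval U1 rho1_gen)"
  by (auto simp: trefoil_group_def presented_group_def rho1_word_class image_image)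

lemma subgroup_rho1_image: "subgroup (rho1 ` carrier trefoil_group) U1"
proof -
  interpret group_hom trefoil_group U1 rho1
    by (intro group_hom.intro group_hom_axioms.intro rho1_hom group_U1)
      (simp add: trefoil_group_def group_presented_group)
  show ?thesis by (rule img_is_subgroup)
qed

lemma rho1_gen_modular:
  "rho1_gen Gen_a = modular_quat (1, 1, 0, 1)" "rho1_gen Gen_b = modular_quat (1, 0, -1, 1)"
  by (simp_all add: quat_arith quat_i_def quat_j_def)

lemma word_eval_modular: "word_eval U1 rho1_gen w \<in> modular_quat ` SL2Z"
proof (induction w)
  case Nil
  then show ?case
    by (auto simp: word_eval_def one_quat_def intro!: image_eqI[of _ _ "(1, 0, 0, 1)"])
next
  case (Cons x w)
  obtain g e where x: "x = (g, e)" by fastforce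
  obtain h where h: "h \<in> SL2Z" "rho1_gen g = modular_quat h"
  proof (cases g)
    case Gen_a
    then show ?thesis using that[of "(1, 1, 0, 1)"] by (simp add: rho1_gen_modular del: rho1_gen.simps)
  next
    case Gen_b
    then show ?thesis using that[of "(1, 0, -1, 1)"] by (simp add: rho1_gen_modular del: rho1_gen.simps)
  qed
  define h' where "h' = (if e then h else imat_adj h)"
  have h': "h' \<in> SL2Z" using h by (simp add: h'_def)
  obtain k where k: "k \<in> SL2Z" "word_eval U1 rho1_gen w = modular_quat k"
    using Cons by auto
  have "word_eval U1 rho1_gen (x # w) = modular_quat h' * modular_quat k"
    unfolding k(2)[symmetric]
    by (simp add: word_eval_def x h h'_def inv_U1 qnorm_modular_quat modular_quat_inverse)
  also have "\<dots> = modular_quat (imat_mult h' k)"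
    by (rule modular_quat_mult[symmetric])
  finally show ?case using h' k by auto
qed

text \<open>Euclidean algorithm on the first column: a translation replaces a by a mod c, and the
  inversion then moves the remainder to the lower left, so |c| decreases. Allowing every power n of
  the translation makes one division a single step.\<close>

lemma SL2Z_induct [consumes 1, case_names one T_left S_left]:
  assumes "g \<in> SL2Z"
    and "P (1, 0, 0, 1)"
    and T: "\<And>g n. g \<in> SL2Z \<Longrightarrow> P g \<Longrightarrow> P (imat_mult (1, n, 0, 1) g)"
    and S: "\<And>g. g \<in> SL2Z \<Longrightarrow> P g \<Longrightarrow> P (imat_mult (0, 1, -1, 0) g)"
  shows "P g"
  using assms(1)
proof (induction g rule: measure_induct_rule[of "\<lambda>(a, b, c, d). nat \<bar>c\<bar>"])
  case (less g)
  obtain a b c d where g: "g = (a, b, c, d)" by (cases g)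
  have det: "a * d - b * c = 1" using less.prems g by simp
  \<comment> \<open>The inversion squares to minus the identity, so P is closed under changing all
    signs.\<close>
  have S2: "P (- a', - b', - c', - d')" if "P (a', b', c', d')" "a' * d' - b' * c' = 1" for a' b' c' d'
    using S[OF _ S[of "(a', b', c', d')"]] that by (simp add: algebra_simps)
  show ?case
  proof (cases "c = 0")
    case True
    then have "a * d = 1" using det by simp
    then have "a = 1 \<and> d = 1 \<or> a = -1 \<and> d = -1" by (metis zmult_eq_1_iff)
    moreover have Tb: "P (1, n, 0, 1)" for n using T[of "(1, 0, 0, 1)" n] assms(2) by simp
    moreover have "P (-1, n, 0, -1)" for n using S2[OF Tb[of "-n"]] by simp
    ultimately show ?thesis using g True by auto
  next
    case False
    define n where "n = a div c"
    define r where "r = a mod c"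
    have a: "a = r + n * c" by (simp add: r_def n_def)
    \<comment> \<open>Chosen so that g is the translation by n applied to minus the inversion of h,
      while the lower left entry of h is the remainder up to sign.\<close>
    define h where "h = (c, d, - r, - (b - n * d))"
    have "nat \<bar>- r\<bar> < nat \<bar>c\<bar>"
      using abs_mod_less[OF False, of a] by (simp add: r_def)
    moreover have hS: "h \<in> SL2Z" using det unfolding h_def a by (simp add: algebra_simps)
    ultimately have "P h" using less.IH[of h] by (simp add: g h_def)
    from S[OF hS this] have "P (- r, - (b - n * d), - c, - d)"
      by (simp add: h_def)
    from S2[OF this] have "P (r, b - n * d, c, d)"
      using hS by (simp add: h_def algebra_simps)
    with T[of "(r, b - n * d, c, d)" n] hS show ?thesis
      by (simp add: g a h_def algebra_simps)
  qed
qed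

lemma rho1_image: "rho1 ` carrier trefoil_group = modular_quat ` SL2Z"
proof
  show "rho1 ` carrier trefoil_group \<subseteq> modular_quat ` SL2Z"
    using word_eval_modular by (auto simp: rho1_image_eq_range)
next
  define G where "G = rho1 ` carrier trefoil_group"
  interpret subgroup G U1 unfolding G_def by (rule subgroup_rho1_image)
  have mult: "modular_quat (imat_mult g h) \<in> G" if "modular_quat g \<in> G" "modular_quat h \<in> G" for g h
    using m_closed[OF that] by (simp add: modular_quat_mult)
  have gen: "rho1_gen x \<in> G" for x
    unfolding G_def rho1_image_eq_range
    by (rule range_eqI[of _ _ "[(x, True)]"]) (simp add: word_eval_def)
  have a: "modular_quat (1, 1, 0, 1) \<in> G" and b: "modular_quat (1, 0, -1, 1) \<in> G"
    using gen rho1_gen_modular by metis+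
  have inv: "modular_quat (imat_adj g) \<in> G" if "modular_quat g \<in> G" "g \<in> SL2Z" for g
    using m_inv_closed[OF that(1)] that by (simp add: inv_U1 qnorm_modular_quat modular_quat_inverse)
  have one: "modular_quat (1, 0, 0, 1) \<in> G"
    using one_closed by (simp add: modular_quat_one del: modular_quat.simps)
  have pos: "modular_quat (1, int n, 0, 1) \<in> G" for n
  proof (induction n)
    case (Suc n)
    then show ?case using mult[OF a Suc] by (simp add: add.commute del: modular_quat.simps)
  qed (simp add: one del: modular_quat.simps)
  have T: "modular_quat (1, n, 0, 1) \<in> G" for n
  proof (cases n rule: int_cases2)
    case (nonneg m)
    then show ?thesis using pos by simp
  next
    case (nonpos m)
    then show ?thesis using inv[OF pos[of m]] by (simp del: modular_quat.simps)
  qed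
  \<comment> \<open>The inversion is the image of the word aba, one side of the defining
    relation.\<close>
  have S: "modular_quat (0, 1, -1, 0) \<in> G"
    using mult[OF a mult[OF b a]] by (simp del: modular_quat.simps)
  have "modular_quat g \<in> G" if "g \<in> SL2Z" for g
    using that
  proof (induction g rule: SL2Z_induct)
    case one
    then show ?case by (rule \<open>modular_quat (1, 0, 0, 1) \<in> G\<close>)
  next
    case (T_left g n)
    then show ?case using mult T by blast
  next
    case (S_left g)
    then show ?case using mult S by blast
  qed
  then show "modular_quat ` SL2Z \<subseteq> rho1 ` carrier trefoil_group"
    unfolding G_def by blast
qed

section \<open>Reduction theory\<close>

text \<open>With the non-strict condition on Im z the set is visibly closed; the other two
  conditions already keep it away from the real axis.\<close>

definition fundamental_domain :: "complex set" where
  "fundamental_domain = {z. Im z \<ge> 0 \<and> \<bar>Re z\<bar> \<le> 1/2 \<and> cmod z \<ge> 1}"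

text \<open>The true minimum is sqrt 3 / 2, at the corners. The rational bound 3/4 is good enough to
  force |c| < 2 in \<open>fundamental_domain_overlap\<close>.\<close>

lemma fundamental_domain_Im:
  assumes "z \<in> fundamental_domain" shows "Im z \<ge> 3/4"
proof -
  have "1 \<le> (cmod z)\<^sup>2" using assms by (simp add: fundamental_domain_def)
  moreover have "(Re z)\<^sup>2 \<le> (1/2)\<^sup>2"
    using assms by (intro abs_le_square_iff[THEN iffD1]) (simp add: fundamental_domain_def)
  ultimately have "(3/4)\<^sup>2 \<le> (Im z)\<^sup>2" unfolding cmod_power2 by (simp add: power2_eq_square)
  then show ?thesis
    by (rule power2_le_imp_le) (use assms in \<open>simp add: fundamental_domain_def\<close>)
qed

lemma fundamental_domain_uhp: "z \<in> fundamental_domain \<Longrightarrow> Im z > 0"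
  using fundamental_domain_Im by fastforce

text \<open>Im (c z + d) = c Im z bounds c by R / e, and then the triangle inequality bounds d. The
  sum of the two bounds serves for both entries.\<close>

lemma row_bound:
  fixes c d :: int
  assumes "Im z \<ge> e" "e > 0" "cmod z \<le> B" "cmod (of_int c * z + of_int d) \<le> R"
  shows "\<bar>c\<bar> \<le> \<lceil>R / e + R / e * B + R\<rceil> \<and> \<bar>d\<bar> \<le> \<lceil>R / e + R / e * B + R\<rceil>"
proof -
  have R: "R \<ge> 0" and B: "B \<ge> 0" using assms norm_ge_zero order_trans by blast+
  have "\<bar>of_int c * Im z\<bar> \<le> R"
    using abs_Im_le_cmod[of "of_int c * z + of_int d"] assms(4) by simp
  then have "\<bar>real_of_int c\<bar> * Im z \<le> R" using assms(1,2) by (simp add: abs_mult)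
  moreover have "\<bar>real_of_int c\<bar> * e \<le> \<bar>real_of_int c\<bar> * Im z"
    using assms(1) by (intro mult_left_mono) auto
  ultimately have c: "\<bar>real_of_int c\<bar> \<le> R / e" using assms(2) by (simp add: field_simps)
  have "\<bar>real_of_int d\<bar> = cmod (of_int c * z + of_int d - of_int c * z)" by simp
  also have "\<dots> \<le> R + \<bar>real_of_int c\<bar> * cmod z"
    using assms(4) by (intro order_trans[OF norm_triangle_ineq4]) (simp add: norm_mult)
  also have "\<dots> \<le> R + R / e * B"
    using c assms(3) R B by (intro add_left_mono mult_mono) auto
  finally have d: "\<bar>real_of_int d\<bar> \<le> R + R / e * B" .
  have "R / e \<ge> 0" "R / e * B \<ge> 0" using R B assms(2) by auto
  with c d R have "\<bar>real_of_int c\<bar> \<le> R / e + R / e * B + R" "\<bar>real_of_int d\<bar> \<le> R / e + R / e * B + R"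
    by linarith+
  then show ?thesis by linarith
qed

text \<open>This gives both proper discontinuity and the local finiteness of the translates of the
  fundamental domain. The bottom row is bounded because |c z + d|^2 is the quotient of the two
  heights, the top row because a z + b is the image point times c z + d.\<close>

lemma finite_SL2Z_returns:
  assumes "e > 0"
  shows "finite {g \<in> SL2Z. \<exists>z. Im z \<ge> e \<and> cmod z \<le> B \<and> Im (mob g z) \<ge> e \<and> cmod (mob g z) \<le> B}"
    (is "finite ?A")
proof -
  \<comment> \<open>B / e + 1 dominates the square root of B / e and hence |c z + d|; the factor max
    1 B makes R a bound for |a z + b| as well.\<close>
  define R where "R = (B / e + 1) * max 1 B"
  define N where "N = \<lceil>R / e + R / e * B + R\<rceil>"
  have "?A \<subseteq> {-N..N} \<times> {-N..N} \<times> {-N..N} \<times> {-N..N}"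
  proof
    fix g assume g: "g \<in> ?A"
    obtain a b c d where abcd: "g = (a, b, c, d)" by (cases g)
    from g obtain z where z: "Im z \<ge> e" "cmod z \<le> B" "Im (mob g z) \<ge> e" "cmod (mob g z) \<le> B"
      and gS: "(a, b, c, d) \<in> SL2Z"
      using abcd by blast
    have B: "B \<ge> e" using z abs_Im_le_cmod[of z] by linarith
    define w where "w = of_int c * z + of_int d"
    have w: "w \<noteq> 0" using mob_denom_nz[of z a d b c] gS z(1) assms by (simp add: w_def)
    have "Im (mob g z) = Im z / (cmod w)\<^sup>2"
      unfolding abcd w_def using gS z(1) assms by (intro Im_mob) auto
    then have "Im z = Im (mob g z) * (cmod w)\<^sup>2" using w by simp
    then have "e * (cmod w)\<^sup>2 \<le> Im z" using z(3) by (simp add: mult_right_mono)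
    also have "\<dots> \<le> B" using z(2) abs_Im_le_cmod[of z] by linarith
    finally have "(cmod w)\<^sup>2 \<le> B / e" using assms by (simp add: field_simps)
    also have "B / e \<le> (B / e + 1)\<^sup>2"
    proof -
      have "0 \<le> B / e" using B assms by simp
      then show ?thesis unfolding power2_sum by (smt (verit) zero_le_power2)
    qed
    finally have w1: "cmod w \<le> B / e + 1"
      by (rule power2_le_imp_le) (use B assms in simp)
    also have "\<dots> \<le> R" using mult_left_mono[of 1 "max 1 B" "B / e + 1"] B assms by (simp add: R_def)
    finally have w2: "cmod (of_int c * z + of_int d) \<le> R" by (simp add: w_def)
    have "of_int a * z + of_int b = mob g z * w" using w by (simp add: abcd w_def)
    then have "cmod (of_int a * z + of_int b) = cmod (mob g z) * cmod w" by (simp add: norm_mult)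
    also have "\<dots> \<le> max 1 B * (B / e + 1)" using w1 z(4) B assms by (intro mult_mono) auto
    finally have "cmod (of_int a * z + of_int b) \<le> R" by (simp add: R_def mult.commute)
    from row_bound[OF z(1) assms z(2) this] row_bound[OF z(1) assms z(2) w2]
    show "g \<in> {-N..N} \<times> {-N..N} \<times> {-N..N} \<times> {-N..N}"
      unfolding N_def[symmetric] abcd by auto
  qed
  then show ?thesis by (rule finite_subset) auto
qed

text \<open>Minimizing |c z + d| over coprime rows maximizes the height in the orbit. After a
  translation into the strip the image has modulus at least 1, since otherwise its top row would be
  a coprime row with a smaller value.\<close>

lemma exists_reduced:
  assumes "Im z > 0"
  shows "\<exists>g\<in>SL2Z. mob g z \<in> fundamental_domain"
proof -
  define f where "f = (\<lambda>(c, d). cmod (of_int c * z + of_int d))"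
  \<comment> \<open>The cut-off at 1 makes the set finite without losing the minimum, because the
    row (0, 1) has value exactly 1.\<close>
  define S where "S = {(c :: int, d :: int). coprime c d \<and> f (c, d) \<le> 1}"
  define N where "N = \<lceil>1 / Im z + 1 / Im z * cmod z + 1\<rceil>"
  have "S \<subseteq> {-N..N} \<times> {-N..N}"
  proof
    fix x assume "x \<in> S"
    then obtain c d where x: "x = (c, d)" "cmod (of_int c * z + of_int d) \<le> 1" 
      by (auto simp: S_def f_def)
    from row_bound[of "Im z" z "cmod z" c d 1] x assms show "x \<in> {-N..N} \<times> {-N..N}"
      unfolding N_def[symmetric] by (auto simp: abs_le_iff)
  qed
  then have "finite S" by (rule finite_subset) auto
  moreover have "(0, 1) \<in> S" by (simp add: S_def f_def)
  ultimately obtain x where "is_arg_min f (\<lambda>x. x \<in> S) x"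
    using ex_is_arg_min_if_finite[of S f] by blast
  then obtain c d where cd: "(c, d) \<in> S" "\<And>c' d'. (c', d') \<in> S \<Longrightarrow> f (c, d) \<le> f (c', d')"
    by (cases x) (auto simp: is_arg_min_linorder)
  have min: "f (c, d) \<le> f (c', d')" if "coprime c' d'" for c' d'
  proof (cases "(c', d') \<in> S")
    case False
    then have "f (c', d') > 1" using that by (simp add: S_def)
    moreover have "f (c, d) \<le> 1" using cd(1) by (simp add: S_def)
    ultimately show ?thesis by simp
  qed (use cd in auto)
  have "coprime d c" using cd(1) by (simp add: S_def coprime_commute)
  then obtain a b' where "a * d + b' * c = 1" using bezout_int[of d c] by (auto simp: coprime_iff_gcd_eq_1)
  define n where "n = round (Re (mob (a, - b', c, d) z))"
  define g where "g = imat_mult (1, - n, 0, 1) (a, - b', c, d)"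
  define A B where "A = a - n * c" "B = - b' - n * d"
  have g_eq: "g = (A, B, c, d)" by (simp add: g_def A_B_def)
  have S1: "(a, - b', c, d) \<in> SL2Z" using \<open>a * d + b' * c = 1\<close> by simp
  have gS: "g \<in> SL2Z" using S1 unfolding g_def by (intro imat_mult_SL2Z) auto
  have "mob g z = mob (1, - n, 0, 1) (mob (a, - b', c, d) z)"
    unfolding g_def using S1 assms by (intro mob_mult) auto
  then have "mob g z = mob (a, - b', c, d) z - of_int n" by simp
  then have "Re (mob g z) = Re (mob (a, - b', c, d) z) - of_int n" by simp
  then have re: "\<bar>Re (mob g z)\<bar> \<le> 1/2"
    unfolding n_def using of_int_round_abs_le[of "Re (mob (a, - b', c, d) z)"] by linarith
  have nz: "of_int c * z + of_int d \<noteq> 0"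
    using mob_denom_nz[OF assms] gS by (simp add: g_eq)
  have "cmod (mob g z) \<ge> 1"
  proof (rule ccontr)
    assume "\<not> ?thesis"
    moreover have "coprime A B"
    proof (rule coprimeI)
      fix k assume "k dvd A" "k dvd B"
      then have "k dvd A * d - B * c" by simp
      then show "is_unit k" using gS by (simp add: g_eq)
    qed
    then have "f (c, d) \<le> f (A, B)" by (rule min)
    moreover have "f (A, B) = cmod (mob g z) * f (c, d)"
      using nz by (simp add: f_def g_eq norm_divide)
    moreover have "f (c, d) > 0" using nz by (simp add: f_def)
    ultimately show False by (simp add: mult_less_cancel_right2 not_le[symmetric])
  qed
  with re gS Im_mob_pos[OF assms gS] show ?thesis
    unfolding fundamental_domain_def by (intro bexI[of _ g]) auto
qed

text \<open>The boundary identification of the fundamental domain.\<close>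

definition folded :: "complex \<Rightarrow> complex \<Rightarrow> bool" where
  "folded u v \<longleftrightarrow> v = u \<or> v = - cnj u \<and> (cmod u = 1 \<or> \<bar>Re u\<bar> = 1/2)"

lemma folded_sym: "folded u v \<Longrightarrow> folded v u"
  by (auto simp: folded_def)

lemma cmod_square_eq_1: "(cmod z)\<^sup>2 = 1 \<Longrightarrow> cmod z = 1"
  using power2_eq_imp_eq[of "cmod z" 1] by simp

lemma mult_cnj_unit: "cmod z = 1 \<Longrightarrow> z * cnj z = 1"
  by (simp flip: complex_norm_square)

lemma int_mult_eq_1_abs: "a * d = (1::int) \<Longrightarrow> a = d \<and> \<bar>d\<bar> = 1"
  using zmult_eq_1_iff[of a d] by auto

text \<open>The height condition says |c u + d| <= 1, which leaves c = 0 or |c| = 1. In the second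
  case the inequalities defining the domain are pushed to equality. The extra information on d
  serves the computation of stabilizers, the formula for the image point serves the gluing.\<close>

lemma fundamental_domain_overlap:
  assumes "u \<in> fundamental_domain" "(a, b, c, d) \<in> SL2Z"
    and "Im (mob (a, b, c, d) u) \<ge> Im u"
  shows "c = 0 \<and> a = d \<and> \<bar>d\<bar> = 1 \<and> mob (a, b, c, d) u = u + of_int (b * d) \<or>
    \<bar>c\<bar> = 1 \<and> cmod u = 1 \<and> mob (a, b, c, d) u = of_int ((a - d) * c) - cnj u \<and>
      (d = 0 \<or> \<bar>d\<bar> = 1 \<and> Re u = - of_int (c * d) / 2)"
proof -
  have u: "Im u > 0" "\<bar>Re u\<bar> \<le> 1/2" "cmod u \<ge> 1" "Im u \<ge> 3/4"
    using assms(1) fundamental_domain_Im[OF assms(1)] by (auto simp: fundamental_domain_def)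
  define w where "w = of_int c * u + of_int d"
  have w0: "w \<noteq> 0" using mob_denom_nz[of u a d b c] assms(2) u(1) by (simp add: w_def)
  have det: "a * d - b * c = 1" using assms(2) by simp
  have "Im (mob (a, b, c, d) u) = Im u / (cmod w)\<^sup>2"
    unfolding w_def using assms(2) u(1) by (intro Im_mob) auto
  with assms(3) have "Im u * (cmod w)\<^sup>2 \<le> Im u * 1" using w0 by (simp add: le_divide_eq)
  then have w1: "(cmod w)\<^sup>2 \<le> 1" using u(1) by (simp only: mult_le_cancel_left_pos)
  then have "cmod w \<le> 1" by (simp add: power_le_one_iff)
  have "\<bar>of_int c * Im u\<bar> \<le> 1"
    using abs_Im_le_cmod[of w] \<open>cmod w \<le> 1\<close> by (simp add: w_def)
  then have "\<bar>real_of_int c\<bar> * Im u \<le> 1" using u(1) by (simp add: abs_mult)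
  moreover have "\<bar>real_of_int c\<bar> * (3/4) \<le> \<bar>real_of_int c\<bar> * Im u"
    using u(4) by (intro mult_left_mono) auto
  ultimately have "\<bar>real_of_int c\<bar> < 2" by linarith
  then have "\<bar>c\<bar> < 2" by linarith
  then consider "c = 0" | "\<bar>c\<bar> = 1" by linarith
  then show ?thesis
  proof cases
    case 1
    with det have "a * d = 1" by simp
    then have ad: "a = d" "\<bar>d\<bar> = 1" using int_mult_eq_1_abs by auto
    then have "d = 1 \<or> d = -1" by linarith
    with 1 ad show ?thesis by auto
  next
    case 2
    then have cc: "real_of_int c * real_of_int c = 1" "c * c = 1"
      by (auto simp: abs_if split: if_splits simp flip: of_int_mult)
    have "(cmod w)\<^sup>2 = (cmod u)\<^sup>2 + 2 * of_int (c * d) * Re u + (of_int d)\<^sup>2"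
    proof -
      have "(cmod w)\<^sup>2 = (of_int c * of_int c) * (Re u * Re u + Im u * Im u) + 2 * of_int (c * d) * Re u + of_int d * of_int d"
        unfolding w_def cmod_power2 by (simp add: power2_eq_square algebra_simps)
      then show ?thesis unfolding cc cmod_power2 by (simp add: power2_eq_square)
    qed
    moreover have "\<bar>2 * of_int (c * d) * Re u\<bar> \<le> \<bar>real_of_int d\<bar>"
    proof -
      have "\<bar>2 * of_int (c * d) * Re u\<bar> = \<bar>real_of_int d\<bar> * (2 * \<bar>Re u\<bar>)"
        using 2 by (simp add: abs_mult flip: of_int_abs)
      also have "\<dots> \<le> \<bar>real_of_int d\<bar> * 1" using u(2) by (intro mult_left_mono) auto
      finally show ?thesis by simp
    qed
    moreover have d2: "(real_of_int d)\<^sup>2 - \<bar>real_of_int d\<bar> = \<bar>real_of_int d\<bar> * (\<bar>real_of_int d\<bar> - 1)"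
      by (simp add: power2_eq_square algebra_simps)
    moreover have d3: "\<bar>real_of_int d\<bar> * (\<bar>real_of_int d\<bar> - 1) \<ge> 0"
      by (cases "d = 0") (auto intro!: mult_nonneg_nonneg simp flip: of_int_abs)
    moreover have u1: "(cmod u)\<^sup>2 \<ge> 1" using u(3) by simp
    \<comment> \<open>Here |w|^2 >= |u|^2 + |d| (|d| - 1) >= 1 meets |w|^2 <= 1, so each estimate
      used is an equality.\<close>
    ultimately have eqs: "(cmod u)\<^sup>2 = 1" "(cmod w)\<^sup>2 = 1" "\<bar>real_of_int d\<bar> * (\<bar>real_of_int d\<bar> - 1) = 0"
      "2 * of_int (c * d) * Re u = - \<bar>real_of_int d\<bar>"
      using w1 by linarith+
    then have norms: "cmod u = 1" "cmod w = 1" by (simp_all add: cmod_square_eq_1)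
    have dd: "d = 0 \<or> \<bar>d\<bar> = 1" using eqs(3) by (auto simp flip: of_int_abs)
    have "Re u = - of_int (c * d) / 2" if "\<bar>d\<bar> = 1"
      using eqs(4) 2 that by (auto simp: abs_if split: if_splits)
    moreover have "mob (a, b, c, d) u = of_int ((a - d) * c) - cnj u"
    proof -
      \<comment> \<open>The image point is a / c - 1 / (c w). With c^2 = 1 and 1 / w =
        \<open>cnj w\<close> this becomes (a - d) c - \<open>cnj u\<close>.\<close>
      have "w * cnj w = 1" using norms(2) by (rule mult_cnj_unit)
      have ccc: "complex_of_int c * complex_of_int c = 1" 
        using cc(2) by (metis of_int_1 of_int_mult)
      have detc: "complex_of_int a * of_int d - of_int b * of_int c = 1"
        using det by (metis of_int_1 of_int_mult of_int_diff)
      have ww: "(of_int c * u + of_int d) * (of_int c * cnj u + of_int d) = 1"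
        using \<open>w * cnj w = 1\<close> by (simp add: w_def)
      have "of_int a * u + of_int b = (of_int ((a - d) * c) - cnj u) * w"
        using ww ccc detc unfolding w_def of_int_mult of_int_diff
        by algebra
      then show ?thesis using w0 by (simp add: w_def)
    qed
    ultimately show ?thesis using 2 norms dd by auto
  qed
qed

lemma equivalent_imp_folded_aux:
  assumes "u \<in> fundamental_domain" "g \<in> SL2Z" "mob g u \<in> fundamental_domain" "Im (mob g u) \<ge> Im u"
  shows "folded u (mob g u)"
proof -
  obtain a b c d where g: "g = (a, b, c, d)" by (cases g)
  define v where "v = mob g u"
  have R: "\<bar>Re u\<bar> \<le> 1/2" "\<bar>Re v\<bar> \<le> 1/2"
    using assms by (auto simp: fundamental_domain_def v_def)
  from fundamental_domain_overlap[of u a b c d] assms g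
  consider "v = u + of_int (b * d)" | "cmod u = 1" "v = of_int ((a - d) * c) - cnj u"
    by (auto simp: v_def)
  then have "folded u v"
  proof cases
    case 1
    define k where "k = b * d"
    have v: "v = u + of_int k" using 1 k_def by simp
    have "Re v = Re u + k" by (simp add: v)
    then have "\<bar>real_of_int k\<bar> \<le> 1" using R by linarith
    then have "k = 0 \<or> k = 1 \<or> k = -1" by linarith
    then show ?thesis using R unfolding v folded_def by (auto simp: complex_eq_iff)
  next
    case 2
    define k where "k = (a - d) * c"
    have v: "v = of_int k - cnj u" using 2 k_def by simp
    have "Re v = k - Re u" by (simp add: v)
    then have "\<bar>real_of_int k\<bar> \<le> 1" using R by linarith
    then have "k = 0 \<or> k = 1 \<or> k = -1" by linarith
    then show ?thesis using R 2(1) unfolding v folded_def by (auto simp: complex_eq_iff)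
  qed
  then show ?thesis by (simp add: v_def)
qed

text \<open>If the image is the lower of the two points, the inverse matrix exchanges their roles;
  \<open>folded\<close> is symmetric.\<close>

lemma equivalent_imp_folded:
  assumes "u \<in> fundamental_domain" "g \<in> SL2Z" "mob g u \<in> fundamental_domain"
  shows "folded u (mob g u)"
proof (cases "Im (mob g u) \<ge> Im u")
  case False
  have *: "mob (imat_adj g) (mob g u) = u"
    using assms fundamental_domain_uhp by (intro mob_adj) auto
  have "folded (mob g u) (mob (imat_adj g) (mob g u))"
    by (rule equivalent_imp_folded_aux) (use assms False in \<open>auto simp: *\<close>)
  then show ?thesis unfolding * by (rule folded_sym)
qed (use assms equivalent_imp_folded_aux in blast)

text \<open>The reflected point is -1/u on the unit circle, and u - 1 or u + 1 on the lines Re u =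
  1/2 and Re u = -1/2.\<close>

lemma folded_imp_equivalent:
  assumes "u \<in> fundamental_domain" "folded u v"
  shows "\<exists>g\<in>SL2Z. mob g u = v"
proof -
  consider "v = u" | "v = - cnj u" "cmod u = 1" | "v = - cnj u" "Re u = 1/2" | "v = - cnj u" "Re u = -1/2"
    using assms(2) unfolding folded_def by (auto simp: abs_if split: if_splits)
  then show ?thesis
  proof cases
    case 1
    then show ?thesis by (intro bexI[of _ "(1, 0, 0, 1)"]) auto
  next
    case 2
    have "u \<noteq> 0" "u * cnj u = 1" using 2 by (auto simp: mult_cnj_unit)
    then have "mob (0, -1, 1, 0) u = v" using 2 by (simp add: field_simps)
    then show ?thesis by (intro bexI[of _ "(0, -1, 1, 0)"]) auto
  next
    case 3
    then have "mob (1, -1, 0, 1) u = v" by (simp add: complex_eq_iff)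
    then show ?thesis by (intro bexI[of _ "(1, -1, 0, 1)"]) auto
  next
    case 4
    then have "mob (1, 1, 0, 1) u = v" by (simp add: complex_eq_iff)
    then show ?thesis by (intro bexI[of _ "(1, 1, 0, 1)"]) auto
  qed
qed

section \<open>Folding the fundamental domain onto the plane\<close>

definition unwrap :: "complex \<Rightarrow> complex" where
  "unwrap z = Complex (Re z) ((cmod z)\<^sup>2 - 1)"

text \<open>\<open>unwrap\<close> straightens the fundamental domain to a half strip, and the cosine glues the sides of the
  half strip and the two halves of its base.\<close>

definition fold_map :: "complex \<Rightarrow> complex" where
  "fold_map z = cos (of_real (2 * pi) * unwrap z)"

lemma continuous_on_fold_map: "continuous_on A fold_map"
  unfolding fold_map_def unwrap_def Complex_eq by (intro continuous_intros)

lemma fundamental_domain_eqI: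
  assumes "Im u \<ge> 0" "Im v \<ge> 0" "Re u = Re v" "cmod u = cmod v"
  shows "u = v"
proof -
  have "(cmod u)\<^sup>2 = (cmod v)\<^sup>2" using assms(4) by simp
  then have "(Im u)\<^sup>2 = (Im v)\<^sup>2" unfolding cmod_power2 using assms(3) by simp
  then show ?thesis using assms by (simp add: complex_eq_iff power2_eq_iff_nonneg)
qed

lemma fold_map_folded:
  assumes "folded u v" shows "fold_map u = fold_map v"
proof -
  \<comment> \<open>The sign s and the integer n encode the two alternatives of
    \<open>complex_cos_eq\<close>: the arc uses s = -1 and n = 0, the vertical sides use s = 1 and n
    = 1 or -1.\<close>
  have *: "fold_map u = fold_map v" if "n \<in> \<int>" "Re u = s * Re v + n"
     "(cmod u)\<^sup>2 - 1 = s * ((cmod v)\<^sup>2 - 1)" "s = 1 \<or> s = -1" for n s :: real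
    unfolding fold_map_def complex_cos_eq
  proof (rule bexI[OF _ that(1)])
    have "unwrap u = of_real s * unwrap v + of_real n"
      using that(2,3) by (simp add: unwrap_def complex_eq_iff)
    then show "of_real (2 * pi) * unwrap u = of_real (2 * pi) * unwrap v + of_real (2 * n * pi) \<or>
      of_real (2 * pi) * unwrap u = - (of_real (2 * pi) * unwrap v) + of_real (2 * n * pi)"
      using that(4) by (auto simp: algebra_simps)
  qed
  consider "v = u" | "v = - cnj u" "cmod u = 1" | "v = - cnj u" "Re u = 1/2" | "v = - cnj u" "Re u = -1/2"
    using assms unfolding folded_def by (auto simp: abs_if split: if_splits)
  then show ?thesis
  proof cases
    case 2
    then show ?thesis by (intro *[of 0 "-1"]) auto
  next
    case 3
    then show ?thesis by (intro *[of 1 1]) auto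
  next
    case 4
    then show ?thesis by (intro *[of "-1" 1]) auto
  qed auto
qed

text \<open>Equal cosines mean equality of the unwrapped points up to sign and an integer. As all
  unwrapped points have real part in [-1/2, 1/2], the integer is 0, 1 or -1, and a nonzero one puts
  both points on vertical sides.\<close>

lemma fold_map_eq_imp_folded:
  assumes "u \<in> fundamental_domain" "v \<in> fundamental_domain" "fold_map u = fold_map v"
  shows "folded u v"
proof -
  have F: "\<bar>Re u\<bar> \<le> 1/2" "\<bar>Re v\<bar> \<le> 1/2" "cmod u \<ge> 1" "cmod v \<ge> 1" "Im u \<ge> 0" "Im v \<ge> 0"
    using assms by (auto simp: fundamental_domain_def)
  have sq: "(cmod u)\<^sup>2 \<ge> 1" "(cmod v)\<^sup>2 \<ge> 1" using F by auto
  obtain n where n: "n \<in> \<int>" and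
    eq: "of_real (2 * pi) * unwrap u = of_real (2 * pi) * unwrap v + of_real (2 * n * pi) \<or>
      of_real (2 * pi) * unwrap u = - (of_real (2 * pi) * unwrap v) + of_real (2 * n * pi)"
    using assms(3) unfolding fold_map_def complex_cos_eq by blast
  obtain k where k: "n = real_of_int k" using n by (auto elim: Ints_cases)
  have "unwrap u = unwrap v + of_real n \<or> unwrap u = - unwrap v + of_real n"
  proof -
    have *: "x = y" if "of_real (2 * pi) * x = of_real (2 * pi) * y" for x y :: complex
      using that by simp
    from eq show ?thesis
      by (elim disj_forward; intro *[of "unwrap u"]) (simp_all add: algebra_simps)
  qed
  then consider
      "Re u = Re v + n" "(cmod u)\<^sup>2 - 1 = (cmod v)\<^sup>2 - 1"
    | "Re u = - Re v + n" "(cmod u)\<^sup>2 - 1 = - ((cmod v)\<^sup>2 - 1)"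
    by (auto simp: unwrap_def complex_eq_iff)
  then show ?thesis
  proof cases
    case 1
    then have norm: "cmod u = cmod v" by (simp add: power2_eq_iff_nonneg)
    have "\<bar>real_of_int k\<bar> \<le> 1" using F 1 unfolding k by linarith
    then consider "k = 0" | "k = 1" | "k = -1" by linarith
    then show ?thesis
    proof cases
      case 1
      then have "u = v" using \<open>Re u = Re v + n\<close> norm F k by (intro fundamental_domain_eqI) auto
      then show ?thesis by (simp add: folded_def)
    next
      case 2
      then have R: "Re u = 1/2" "Re v = -1/2" using \<open>Re u = Re v + n\<close> k F by (auto simp: abs_le_iff)
      have "v = - cnj u" by (rule fundamental_domain_eqI) (use R F norm in auto)
      then show ?thesis using R by (simp add: folded_def)
    next
      case 3
      then have R: "Re u = -1/2" "Re v = 1/2" using \<open>Re u = Re v + n\<close> k F by (auto simp: abs_le_iff)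
      have "v = - cnj u" by (rule fundamental_domain_eqI) (use R F norm in auto)
      then show ?thesis using R by (simp add: folded_def)
    qed
  next
    case 2
    \<comment> \<open>The two heights |u|^2 - 1 and |v|^2 - 1 are nonnegative and opposite, hence
      both zero: the sign change occurs only on the arc.\<close>
    then have "(cmod u)\<^sup>2 = 1" "(cmod v)\<^sup>2 = 1" using sq by linarith+
    then have norm: "cmod u = 1" "cmod v = 1" by (simp_all add: cmod_square_eq_1)
    have "\<bar>real_of_int k\<bar> \<le> 1" using F 2 unfolding k by linarith
    then consider "k = 0" | "k = 1" | "k = -1" by linarith
    then show ?thesis
    proof cases
      case 1
      have "v = - cnj u" by (rule fundamental_domain_eqI) (use 1 \<open>Re u = - Re v + n\<close> k F norm in auto)
      then show ?thesis using norm by (simp add: folded_def)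
    next
      case 2
      then have R: "Re u = 1/2" "Re v = 1/2" using \<open>Re u = - Re v + n\<close> k F by (auto simp: abs_le_iff)
      have "v = u" by (rule fundamental_domain_eqI) (use R F norm in auto)
      then show ?thesis by (simp add: folded_def)
    next
      case 3
      then have R: "Re u = -1/2" "Re v = -1/2" using \<open>Re u = - Re v + n\<close> k F by (auto simp: abs_le_iff)
      have "v = u" by (rule fundamental_domain_eqI) (use R F norm in auto)
      then show ?thesis by (simp add: folded_def)
    qed
  qed
qed

lemma fold_map_surj: "\<exists>z\<in>fundamental_domain. fold_map z = y"
proof -
  define w0 where "w0 = Arccos y / of_real (2 * pi)"
  have w0: "cos (of_real (2 * pi) * w0) = y" by (simp add: w0_def)
  \<comment> \<open>Evenness of the cosine moves the preimage to the upper half plane; its period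
    then moves the real part to [-1/2, 1/2].\<close>
  define w1 where "w1 = (if Im w0 \<ge> 0 then w0 else - w0)"
  have w1: "cos (of_real (2 * pi) * w1) = y" "Im w1 \<ge> 0" using w0 by (auto simp: w1_def)
  define n where "n = round (Re w1)"
  define x s where "x = Re w1 - of_int n" and "s = Im w1"
  have x: "\<bar>x\<bar> \<le> 1/2" unfolding x_def n_def using of_int_round_abs_le[of "Re w1"] by linarith
  have "cos (of_real (2 * pi) * Complex x s) = cos (of_real (2 * pi) * w1)"
    unfolding complex_cos_eq
    by (rule bexI[of _ "- of_int n"]) (auto simp: x_def s_def complex_eq_iff algebra_simps)
  then have c: "cos (of_real (2 * pi) * Complex x s) = y" using w1(1) by (simp only:)
  have "x\<^sup>2 \<le> (1/2)\<^sup>2" using x by (intro abs_le_square_iff[THEN iffD1]) simp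
  also have "\<dots> \<le> 1 + s" using w1(2) by (simp add: s_def power2_eq_square)
  finally have x2: "x\<^sup>2 \<le> 1 + s" .
  \<comment> \<open>Solves \<open>unwrap z = Complex x s\<close>. The radicand is nonnegative
    because x^2 <= 1/4.\<close>
  define z where "z = Complex x (sqrt (1 + s - x\<^sup>2))"
  have z2: "(cmod z)\<^sup>2 = 1 + s" using x2 unfolding z_def cmod_power2 by simp
  have "cmod z \<ge> 1"
    by (rule power2_le_imp_le) (use w1(2) in \<open>simp_all add: z2 s_def\<close>)
  then have "z \<in> fundamental_domain" using x x2 by (simp add: fundamental_domain_def z_def)
  moreover have "unwrap z = Complex x s" unfolding unwrap_def z2 by (simp add: z_def)
  ultimately show ?thesis using c by (intro bexI[of _ z]) (simp_all only: fold_map_def)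
qed

section \<open>Properness of the folding map\<close>

lemma cmod_cos_ge: "Im w \<ge> 0 \<Longrightarrow> Im w \<le> cmod (cos w)"
proof -
  assume w: "Im w \<ge> 0"
  \<comment> \<open>|cos w| is at least sinh (Im w), which is at least Im w.\<close>
  have "(Im w)\<^sup>2 \<le> ((exp (Im w) - inverse (exp (Im w))) / 2)\<^sup>2"
    using real_le_x_sinh[OF w] w by (intro power_mono)
  also have "\<dots> \<le> (cmod (cos w))\<^sup>2"
    unfolding norm_cos_squared by (simp add: power_divide)
  finally show ?thesis by (rule power2_le_imp_le) simp
qed

lemma closed_fundamental_domain: "closed fundamental_domain"
proof -
  have "fundamental_domain = {z. 0 \<le> Im z} \<inter> {z. \<bar>Re z\<bar> \<le> 1/2} \<inter> {z. 1 \<le> cmod z}"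
    by (auto simp: fundamental_domain_def)
  moreover have "closed ({z. 0 \<le> Im z} \<inter> {z. \<bar>Re z\<bar> \<le> 1/2} \<inter> {z. 1 \<le> cmod z})"
    by (intro closed_Int closed_Collect_le continuous_intros)
  ultimately show ?thesis by simp
qed

text \<open>\<open>fold_map\<close> is proper on the domain: a bound on the cosine bounds |z|^2 - 1,
  so preimages of a convergent sequence have a convergent subsequence.\<close>

lemma closed_fold_map_image:
  assumes "closed S" "S \<subseteq> fundamental_domain"
  shows "closed (fold_map ` S)"
  unfolding closed_sequential_limits
proof (intro allI impI, elim conjE)
  fix f l assume f: "\<forall>n. f n \<in> fold_map ` S" and l: "f \<longlonglongrightarrow> l"
  then have "\<forall>n. \<exists>z\<in>S. f n = fold_map z" by blast
  then obtain z where z: "\<And>n. z n \<in> S" "\<And>n. f n = fold_map (z n)" by metis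
  have "bounded (range f)" using l convergent_imp_bounded by blast
  then obtain B where B: "\<And>n. cmod (f n) \<le> B" by (auto simp: bounded_iff)
  have "cmod (z n) \<le> B + 2" for n
  proof -
    define s where "s = (cmod (z n))\<^sup>2 - 1"
    have "cmod (z n) \<ge> 1" using z(1) assms(2) by (auto simp: fundamental_domain_def)
    then have "s \<ge> 0" by (simp add: s_def)
    have "2 * pi * s \<le> cmod (f n)"
      using cmod_cos_ge[of "of_real (2 * pi) * unwrap (z n)"] \<open>s \<ge> 0\<close>
      by (simp add: z(2) fold_map_def unwrap_def s_def)
    moreover have "1 * s \<le> (2 * pi) * s" using \<open>s \<ge> 0\<close> pi_gt3 by (intro mult_right_mono) auto
    ultimately have "s \<le> B" using B[of n] by linarith
    moreover have "1 * cmod (z n) \<le> (cmod (z n))\<^sup>2"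
      unfolding power2_eq_square using \<open>cmod (z n) \<ge> 1\<close> by (intro mult_right_mono) auto
    ultimately show ?thesis unfolding s_def by linarith
  qed
  then have "bounded (range z)" by (auto simp: bounded_iff)
  then obtain w r where r: "strict_mono r" "(z \<circ> r) \<longlonglongrightarrow> w"
    using bounded_imp_convergent_subsequence by blast
  have "w \<in> S" using assms(1) r(2) z(1) unfolding closed_sequential_limits by (metis comp_apply)
  have "isCont fold_map w"
    using continuous_on_fold_map[of UNIV] by (simp add: continuous_on_eq_continuous_at)
  then have "(\<lambda>n. fold_map ((z \<circ> r) n)) \<longlonglongrightarrow> fold_map w"
    using r(2) by (rule isCont_tendsto_compose)
  moreover have "(f \<circ> r) \<longlonglongrightarrow> l" using l r(1) by (rule LIMSEQ_subseq_LIMSEQ)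
  ultimately have "fold_map w = l" by (simp add: comp_def z(2)[symmetric]) (metis LIMSEQ_unique)
  then show "l \<in> fold_map ` S" using \<open>w \<in> S\<close> by blast
qed

lemma quotient_map_fold_map: "quotient_map (top_of_set fundamental_domain) euclidean fold_map"
proof (rule continuous_closed_imp_quotient_map)
  show "continuous_map (top_of_set fundamental_domain) euclidean fold_map"
    by (simp add: continuous_on_fold_map)
  show "closed_map (top_of_set fundamental_domain) euclidean fold_map"
    unfolding closed_map_def
    using closed_fundamental_domain closed_fold_map_image closedin_closed_eq by auto
  show "fold_map ` topspace (top_of_set fundamental_domain) = topspace euclidean"
    using fold_map_surj by (metis UNIV_eq_I image_eqI topspace_euclidean topspace_euclidean_subtopology)
qed

section \<open>The quotient map\<close>

lemma continuous_on_mob: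
  assumes "g \<in> SL2Z" shows "continuous_on upper_half_plane (mob g)"
proof (cases g)
  case (fields a b c d)
  have "continuous_on upper_half_plane (\<lambda>z. (of_int a * z + of_int b) / (of_int c * z + of_int d))"
    using mob_denom_nz[of _ a d b c] assms fields by (intro continuous_intros) auto
  then show ?thesis unfolding fields by (simp add: mob.simps[abs_def])
qed

lemma mob_sym:
  assumes "Im z > 0" "\<exists>g\<in>SL2Z. mob g z = w" shows "\<exists>g\<in>SL2Z. mob g w = z"
  using assms mob_adj imat_adj_SL2Z by metis

lemma mob_trans:
  assumes "Im z > 0" "\<exists>g\<in>SL2Z. mob g z = w" "\<exists>g\<in>SL2Z. mob g w = x"
  shows "\<exists>g\<in>SL2Z. mob g z = x"
  using assms mob_mult imat_mult_SL2Z by metis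

definition reduced :: "complex \<Rightarrow> complex" where
  "reduced z = (SOME u. u \<in> fundamental_domain \<and> (\<exists>g\<in>SL2Z. mob g z = u))"

lemma reduced:
  assumes "Im z > 0"
  shows "reduced z \<in> fundamental_domain" "\<exists>g\<in>SL2Z. mob g z = reduced z"
proof -
  have "\<exists>u. u \<in> fundamental_domain \<and> (\<exists>g\<in>SL2Z. mob g z = u)"
    using exists_reduced[OF assms] by blast
  from someI_ex[OF this] show "reduced z \<in> fundamental_domain" "\<exists>g\<in>SL2Z. mob g z = reduced z"
    unfolding reduced_def by auto
qed

text \<open>On the boundary \<open>reduced\<close> may choose among several points, but
  \<open>fold_map\<close> takes the same value at all of them.\<close>

definition orbit_map :: "complex \<Rightarrow> complex" where
  "orbit_map z = fold_map (reduced z)"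

lemma fold_map_eq_iff:
  assumes "u \<in> fundamental_domain" "v \<in> fundamental_domain"
  shows "fold_map u = fold_map v \<longleftrightarrow> (\<exists>g\<in>SL2Z. mob g u = v)"
  using assms fold_map_eq_imp_folded folded_imp_equivalent equivalent_imp_folded fold_map_folded
  by metis

lemma orbit_map_eq_iff:
  assumes "Im z > 0" "Im w > 0"
  shows "orbit_map z = orbit_map w \<longleftrightarrow> (\<exists>g\<in>SL2Z. mob g z = w)"
proof -
  note rz = reduced[OF assms(1)] and rw = reduced[OF assms(2)]
  have pos: "Im (reduced z) > 0" "Im (reduced w) > 0"
    using rz rw fundamental_domain_uhp by auto
  have "orbit_map z = orbit_map w \<longleftrightarrow> (\<exists>g\<in>SL2Z. mob g (reduced z) = reduced w)"
    unfolding orbit_map_def using rz rw by (intro fold_map_eq_iff)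
  also have "\<dots> \<longleftrightarrow> (\<exists>g\<in>SL2Z. mob g z = w)"
    using mob_trans[OF assms(1) rz(2)] mob_sym[OF assms(1) rz(2)] mob_sym[OF assms(2) rw(2)]
      mob_trans[OF assms(1), of w] mob_trans[OF assms(1), of "reduced w"]
      mob_trans[OF pos(1), of z] mob_trans[OF pos(1), of w] rw(2)
    by blast
  finally show ?thesis .
qed

lemma orbit_map_fundamental:
  assumes "u \<in> fundamental_domain" shows "orbit_map u = fold_map u"
  using reduced[OF fundamental_domain_uhp[OF assms]] assms fold_map_eq_iff unfolding orbit_map_def by metis

text \<open>Removes the choice: on each translate of the fundamental domain the map has an explicit
  continuous formula, ready for pasting.\<close>

lemma orbit_map_mob:
  assumes "Im z > 0" "g \<in> SL2Z" "mob g z \<in> fundamental_domain"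
  shows "orbit_map z = fold_map (mob g z)"
  using assms orbit_map_eq_iff[of z "mob g z"] orbit_map_fundamental[of "mob g z"] fundamental_domain_uhp
  by auto

text \<open>Either c = 0 and the height is unchanged, or |c z + d| >= Im z and the new height is at
  most 1 / Im z; the sum covers both. Thus translates meeting a small ball do so at bounded
  height.\<close>

lemma Im_mob_le:
  assumes "Im z > 0" "g \<in> SL2Z" shows "Im (mob g z) \<le> Im z + 1 / Im z"
proof (cases g)
  case (fields a b c d)
  define w where "w = of_int c * z + of_int d"
  have eq: "Im (mob g z) = Im z / (cmod w)\<^sup>2"
    unfolding fields w_def using assms fields by (intro Im_mob) auto
  show ?thesis
  proof (cases "c = 0")
    case True
    then have "a * d = 1" using assms fields by simp
    then have "\<bar>d\<bar> = 1" using int_mult_eq_1_abs by blast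
    then have "cmod w = 1" using True by (simp add: w_def flip: of_int_abs)
    then show ?thesis using eq assms(1) by simp
  next
    case False
    then have "1 * Im z \<le> \<bar>real_of_int c\<bar> * Im z" using assms(1) by (intro mult_right_mono) (auto simp flip: of_int_abs)
    also have "\<dots> = \<bar>Im w\<bar>" using assms(1) by (simp add: w_def abs_mult)
    also have "\<dots> \<le> cmod w" by (rule abs_Im_le_cmod)
    finally have "Im z \<le> cmod w" by simp
    then have "(Im z)\<^sup>2 \<le> (cmod w)\<^sup>2" using assms(1) by (intro power_mono) auto
    then have "Im z / (cmod w)\<^sup>2 \<le> Im z / (Im z)\<^sup>2"
      using assms(1) \<open>Im z \<le> cmod w\<close> by (intro divide_left_mono mult_pos_pos zero_less_power) auto
    also have "\<dots> = 1 / Im z" using assms(1) by (simp add: power2_eq_square)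
    finally show ?thesis unfolding eq using assms(1) by simp
  qed
qed

text \<open>\<open>reduced\<close> may jump between translates, so continuity comes from pasting the
  formulas of \<open>orbit_map_mob\<close> over the closed preimages of the fundamental domain.
  Local finiteness is what allows infinitely many closed pieces.\<close>

lemma continuous_map_orbit_map: "continuous_map (top_of_set upper_half_plane) euclidean orbit_map"
proof (rule pasting_lemma_locally_finite[where I = SL2Z and f = "\<lambda>g. fold_map \<circ> mob g"
      and T = "\<lambda>g. upper_half_plane \<inter> mob g -` fundamental_domain"])
  fix x assume "x \<in> topspace (top_of_set upper_half_plane)"
  then have x: "Im x > 0" by simp
  define e where "e = Im x / 2"
  define V where "V = upper_half_plane \<inter> ball x e"
  \<comment> \<open>Near x one has |z| < |x| + e; an image in the domain has height at most |x| + e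
    + 1 / e and real part at most 1/2 in absolute value. B bounds both moduli.\<close>
  define B where "B = cmod x + e + 1 / e + 1 / 2"
  have e: "e > 0" using x by (simp add: e_def)
  have "{g \<in> SL2Z. (upper_half_plane \<inter> mob g -` fundamental_domain) \<inter> V \<noteq> {}} \<subseteq>
    {g \<in> SL2Z. \<exists>z. Im z \<ge> min e (3/4) \<and> cmod z \<le> B \<and> Im (mob g z) \<ge> min e (3/4) \<and> cmod (mob g z) \<le> B}"
  proof safe
    fix g z assume g: "g \<in> SL2Z" and z: "z \<in> upper_half_plane" "mob g z \<in> fundamental_domain" "z \<in> V"
    have "dist x z < e" using z by (simp add: V_def)
    then have "\<bar>Im x - Im z\<bar> < e" "cmod z < cmod x + e"
      using abs_Im_le_cmod[of "x - z"] norm_triangle_ineq3[of x z] by (auto simp: dist_norm)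
    then have ze: "Im z \<ge> e" by (simp add: e_def abs_if split: if_splits)
    have "Im (mob g z) \<le> Im z + 1 / Im z" using z g by (intro Im_mob_le) auto
    also have "1 / Im z \<le> 1 / e" using ze e by (intro divide_left_mono) auto
    finally have "Im (mob g z) \<le> cmod x + e + 1 / e"
      using \<open>cmod z < cmod x + e\<close> abs_Im_le_cmod[of z] by linarith
    moreover have "\<bar>Re (mob g z)\<bar> \<le> 1/2" "Im (mob g z) \<ge> 3/4"
      using z(2) fundamental_domain_Im[OF z(2)] by (auto simp: fundamental_domain_def)
    ultimately have "cmod (mob g z) \<le> B" "Im (mob g z) \<ge> min e (3/4)"
      using cmod_le[of "mob g z"] by (auto simp: B_def)
    moreover have "cmod z \<le> B" using \<open>cmod z < cmod x + e\<close> e by (simp add: B_def add_increasing2)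
    ultimately show "\<exists>z. Im z \<ge> min e (3/4) \<and> cmod z \<le> B \<and> Im (mob g z) \<ge> min e (3/4) \<and> cmod (mob g z) \<le> B"
      using ze by (intro exI[of _ z]) auto
  qed
  moreover have "finite \<dots>" using e by (intro finite_SL2Z_returns) auto
  ultimately have "finite {g \<in> SL2Z. (upper_half_plane \<inter> mob g -` fundamental_domain) \<inter> V \<noteq> {}}"
    by (rule finite_subset)
  moreover have "openin (top_of_set upper_half_plane) V" "x \<in> V"
    using x e by (auto simp: V_def)
  ultimately show "\<exists>V. openin (top_of_set upper_half_plane) V \<and> x \<in> V \<and>
      finite {g \<in> SL2Z. (upper_half_plane \<inter> mob g -` fundamental_domain) \<inter> V \<noteq> {}}"
    by blast
next
  fix g assume g: "g \<in> SL2Z"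
  show "closedin (top_of_set upper_half_plane) (upper_half_plane \<inter> mob g -` fundamental_domain)"
    using continuous_on_mob[OF g] closed_fundamental_domain by (rule continuous_closedin_preimage)
  have "continuous_on (upper_half_plane \<inter> mob g -` fundamental_domain) (fold_map \<circ> mob g)"
    using continuous_on_subset[OF continuous_on_mob[OF g]] continuous_on_fold_map
    by (intro continuous_on_compose) auto
  then show "continuous_map (subtopology (top_of_set upper_half_plane)
      (upper_half_plane \<inter> mob g -` fundamental_domain)) euclidean (fold_map \<circ> mob g)"
    by (simp add: subtopology_subtopology)
next
  fix g h x assume "g \<in> SL2Z" "h \<in> SL2Z" "x \<in> topspace (top_of_set upper_half_plane) \<inter>
    (upper_half_plane \<inter> mob g -` fundamental_domain) \<inter> (upper_half_plane \<inter> mob h -` fundamental_domain)"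
  then show "(fold_map \<circ> mob g) x = (fold_map \<circ> mob h) x"
    using orbit_map_mob[of x g] orbit_map_mob[of x h] by auto
next
  fix x assume "x \<in> topspace (top_of_set upper_half_plane)"
  then show "\<exists>g. g \<in> SL2Z \<and> x \<in> upper_half_plane \<inter> mob g -` fundamental_domain \<and>
      orbit_map x = (fold_map \<circ> mob g) x"
    using exists_reduced[of x] orbit_map_mob[of x] unfolding comp_apply by fastforce
qed

lemma continuous_on_hyp_chart: "continuous_on hyp_plane hyp_chart"
  unfolding hyp_chart_def Complex_eq by (intro continuous_intros) (auto simp: hyp_plane_iff)

lemma continuous_on_hyp_chart_inv: "continuous_on upper_half_plane hyp_chart_inv"
proof -
  have "\<forall>i. continuous_on upper_half_plane (\<lambda>w. hyp_chart_inv w $ i)"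
    unfolding hyp_chart_inv_def forall_3 vector_3 
    by (intro conjI continuous_intros) auto
  then have "continuous_on upper_half_plane (\<lambda>w. \<chi> i. hyp_chart_inv w $ i)"
    by (intro continuous_on_vec_lambda) blast
  then show ?thesis by simp
qed

text \<open>A continuous map is a quotient map once its composition with some continuous map into
  its domain is one. Here the inverse chart on the fundamental domain turns it into
  \<open>fold_map\<close>.\<close>

lemma quotient_map_orbit_map:
  "quotient_map (top_of_set hyp_plane) euclidean (orbit_map \<circ> hyp_chart)"
proof (rule quotient_map_from_composition)
  show "continuous_map (top_of_set fundamental_domain) (top_of_set hyp_plane) hyp_chart_inv"
    using continuous_on_subset[OF continuous_on_hyp_chart_inv] fundamental_domain_uhp hyp_chart_inv_in
    by (auto simp: subset_eq)
  have "continuous_map (top_of_set hyp_plane) (top_of_set upper_half_plane) hyp_chart"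
    using continuous_on_hyp_chart hyp_chart_pos by auto
  then show "continuous_map (top_of_set hyp_plane) euclidean (orbit_map \<circ> hyp_chart)"
    using continuous_map_orbit_map by (rule continuous_map_compose)
  show "quotient_map (top_of_set fundamental_domain) euclidean (orbit_map \<circ> hyp_chart \<circ> hyp_chart_inv)"
    using quotient_map_fold_map
    by (rule quotient_map_eq)
      (auto simp: hyp_chart_chart_inv fundamental_domain_uhp orbit_map_fundamental)
qed

lemma punctured_sphere_homeomorphism:
  fixes n :: "real^3" assumes "norm n = 1"
  obtains h :: "complex \<Rightarrow> real^3"
  where "homeomorphic_map euclidean (top_of_set (sphere 0 1 - {n})) h"
proof -
  have "(sphere 0 1 - {n}) homeomorphic (UNIV :: complex set)"
    using assms by (intro homeomorphic_punctured_sphere_affine) auto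
  then obtain f :: "real^3 \<Rightarrow> complex" and h where fh: "homeomorphism (sphere 0 1 - {n}) UNIV f h"
    unfolding homeomorphic_def by blast
  then have "homeomorphic_maps euclidean (top_of_set (sphere 0 1 - {n})) h f"
    unfolding homeomorphic_maps_def homeomorphism_def continuous_map_in_subtopology by auto
  then show ?thesis using that homeomorphic_map_maps by blast
qed

section \<open>Stabilizers\<close>

definition stab :: "complex \<Rightarrow> (real^3^3) set" where
  "stab z = modular_isom ` {g \<in> SL2Z. mob g z = z}"

lemma modular_isom_mult: "modular_isom (imat_mult g h) = modular_isom g ** modular_isom h"
  by (simp add: modular_quat_mult c_map_mult)

lemma modular_isom_one: "modular_isom (1, 0, 0, 1) = mat 1"
  by (simp add: modular_quat_one c_map_one del: modular_quat.simps)

lemma modular_isom_minus: "modular_isom (- a, - b, - c, - d) = modular_isom (a, b, c, d)"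
  by (simp add: c_map_explicit power2_eq_square field_simps)

text \<open>Its contrapositive distinguishes isometries by evaluating Moebius maps at one
  point.\<close>

lemma modular_isom_eq_imp_mob_eq:
  assumes "modular_isom g = modular_isom h" "g \<in> SL2Z" "h \<in> SL2Z" "Im z > 0"
  shows "mob g z = mob h z"
  using modular_isom_hyp_plane_chart[of "hyp_chart_inv z"] assms
  by (metis hyp_chart_inv_in hyp_chart_chart_inv)

lemma stab_conj:
  assumes "Im z > 0" "h \<in> SL2Z" "M \<in> stab z"
  shows "modular_isom h ** M ** modular_isom (imat_adj h) \<in> stab (mob h z)"
proof -
  obtain g where g: "g \<in> SL2Z" "mob g z = z" "M = modular_isom g"
    using assms(3) by (auto simp: stab_def)
  have p: "Im (mob h z) > 0" using assms Im_mob_pos by blast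
  have "mob (imat_mult (imat_mult h g) (imat_adj h)) (mob h z) = mob h z"
    using assms g p by (simp add: mob_mult mob_adj)
  then show ?thesis
    unfolding stab_def g(3) modular_isom_mult[symmetric] using assms g by (intro imageI) simp
qed

text \<open>Stabilizers along an orbit are conjugate, so their orders need to be found only in the
  fundamental domain.\<close>

lemma card_stab_mob:
  assumes "Im z > 0" "h \<in> SL2Z"
  shows "card (stab (mob h z)) = card (stab z)" "finite (stab (mob h z)) \<longleftrightarrow> finite (stab z)"
proof -
  let ?N = "modular_isom h" and ?N' = "modular_isom (imat_adj h)"
  have inv: "?N ** ?N' = mat 1" "?N' ** ?N = mat 1"
    using assms(2) by (simp_all only: modular_isom_mult[symmetric] imat_mult_adj imat_adj_mult modular_isom_one)
  have l: "?N' ** (?N ** M ** ?N') ** ?N = M" "?N ** (?N' ** M ** ?N) ** ?N' = M" for M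
    using inv by (metis matrix_mul_assoc matrix_mul_lid matrix_mul_rid)+
  have "bij_betw (\<lambda>M. ?N ** M ** ?N') (stab z) (stab (mob h z))"
  proof (rule bij_betwI[where g = "\<lambda>M. ?N' ** M ** ?N"])
    show "(\<lambda>M. ?N ** M ** ?N') \<in> stab z \<rightarrow> stab (mob h z)"
      using stab_conj[OF assms] by blast
    show "(\<lambda>M. ?N' ** M ** ?N) \<in> stab (mob h z) \<rightarrow> stab z"
      using stab_conj[of "mob h z" "imat_adj h"] assms Im_mob_pos by (auto simp: mob_adj)
  qed (use l in auto)
  then show "card (stab (mob h z)) = card (stab z)" "finite (stab (mob h z)) \<longleftrightarrow> finite (stab z)"
    using bij_betw_same_card bij_betw_finite by metis+
qed

text \<open>The list has to contain each stabilizing matrix only up to sign, since g and -g give the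
  same isometry.\<close>

lemma stab_eq_image:
  assumes "Im u > 0" "\<And>g. g \<in> set gs \<Longrightarrow> g \<in> SL2Z \<and> mob g u = u"
    and "\<And>a b c d. (a, b, c, d) \<in> SL2Z \<Longrightarrow> mob (a, b, c, d) u = u \<Longrightarrow>
      (a, b, c, d) \<in> set gs \<or> (- a, - b, - c, - d) \<in> set gs"
  shows "stab u = modular_isom ` set gs"
proof
  show "modular_isom ` set gs \<subseteq> stab u" using assms(2) by (auto simp: stab_def)
  show "stab u \<subseteq> modular_isom ` set gs"
  proof
    fix M assume "M \<in> stab u"
    then obtain a b c d where g: "(a, b, c, d) \<in> SL2Z" "mob (a, b, c, d) u = u" "M = modular_isom (a, b, c, d)"
      unfolding stab_def by auto
    from assms(3)[OF g(1,2)] show "M \<in> modular_isom ` set gs"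
    proof
      assume "(- a, - b, - c, - d) \<in> set gs"
      then show ?thesis unfolding g(3) modular_isom_minus[of a, symmetric] by (rule imageI)
    qed (unfold g(3), rule imageI)
  qed
qed

text \<open>A fixed point has unchanged height, so \<open>fundamental_domain_overlap\<close>
  applies. Comparing real parts in the fixed point equation gives Re u = (a - d) c / 2, which forces
  a = 0 unless d = 0.\<close>

lemma fundamental_domain_stabilizer:
  assumes "u \<in> fundamental_domain" "(a, b, c, d) \<in> SL2Z" "mob (a, b, c, d) u = u"
  obtains "c = 0" "b = 0" "a = d" "\<bar>d\<bar> = 1"
    | "\<bar>c\<bar> = 1" "cmod u = 1" "d = 0" "b = - c" "Re u = of_int (a * c) / 2"
    | "\<bar>c\<bar> = 1" "cmod u = 1" "a = 0" "\<bar>d\<bar> = 1" "b = - c" "Re u = - of_int (c * d) / 2"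
proof -
  have det: "a * d - b * c = 1" using assms(2) by simp
  from fundamental_domain_overlap[OF assms(1,2)] assms(3)
  consider "c = 0" "a = d" "\<bar>d\<bar> = 1" "u = u + of_int (b * d)"
    | "\<bar>c\<bar> = 1" "cmod u = 1" "u = of_int ((a - d) * c) - cnj u"
      "d = 0 \<or> \<bar>d\<bar> = 1 \<and> Re u = - of_int (c * d) / 2"
    by auto
  then show ?thesis
  proof cases
    case 1
    then have "b = 0" by auto
    then show ?thesis using 1 that by blast
  next
    case 2
    have c: "c = 1 \<or> c = -1" using 2(1) by linarith
    have "Re u = of_int ((a - d) * c) - Re u" using arg_cong[OF 2(3), of Re] by simp
    then have re: "Re u = of_int ((a - d) * c) / 2" by simp
    from 2(4) show ?thesis
    proof
      assume "d = 0"
      then have "b = - c" using det c by auto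
      then show ?thesis using that(2) 2(1,2) re \<open>d = 0\<close> by simp
    next
      assume d: "\<bar>d\<bar> = 1 \<and> Re u = - of_int (c * d) / 2"
      then have "real_of_int ((a - d) * c) = - real_of_int (c * d)" using re by simp
      then have "(a - d) * c = - (c * d)" by linarith
      then have "a = 0" using c by auto
      then have "b = - c" using det c by auto
      then show ?thesis using that(3) 2(1,2) d \<open>a = 0\<close> by blast
    qed
  qed
qed

text \<open>This is exp (i pi / 3). With its reflection exp (2 i pi / 3) it forms the two lower
  vertices of the domain, which are glued to one cone point.\<close>

definition corner :: complex where
  "corner = Complex (1/2) (sqrt 3 / 2)"

lemma cmod_corner: "cmod corner = 1"
  unfolding corner_def by (simp add: cmod_def power_divide)

lemma corner_fundamental: "corner \<in> fundamental_domain" "- cnj corner \<in> fundamental_domain" "\<i> \<in> fundamental_domain"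
  using cmod_corner by (simp_all add: fundamental_domain_def) (simp_all add: corner_def)

lemma unit_fundamental_cases:
  assumes "u \<in> fundamental_domain" "cmod u = 1"
  shows "Re u = 0 \<Longrightarrow> u = \<i>" "Re u = 1/2 \<Longrightarrow> u = corner" "Re u = -1/2 \<Longrightarrow> u = - cnj corner"
proof -
  have "u = w" if "Re u = Re w" "w \<in> fundamental_domain" "cmod w = 1" for w
    using that assms by (intro fundamental_domain_eqI) (auto simp: fundamental_domain_def)
  note * = this[OF _ corner_fundamental(1)] this[OF _ corner_fundamental(2)] this[OF _ corner_fundamental(3)]
  show "Re u = 0 \<Longrightarrow> u = \<i>" by (rule *(3)) simp_all
  show "Re u = 1/2 \<Longrightarrow> u = corner" by (rule *(1)) (simp_all add: cmod_corner, simp add: corner_def)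
  show "Re u = -1/2 \<Longrightarrow> u = - cnj corner" by (rule *(2)) (simp_all add: cmod_corner, simp add: corner_def)
qed

lemma fold_map_special:
  "fold_map \<i> = 1" "fold_map corner = -1" "fold_map (- cnj corner) = -1"
proof -
  show "fold_map \<i> = 1" by (simp add: fold_map_def unwrap_def flip: zero_complex.code)
  have w: "unwrap corner = of_real (1/2)" unfolding unwrap_def cmod_corner by (simp add: corner_def complex_eq_iff)
  have "fold_map corner = cos (of_real pi)" unfolding fold_map_def w by simp
  then show 1: "fold_map corner = -1" by (simp only: cos_of_real) simp
  show "fold_map (- cnj corner) = -1"
    unfolding 1[symmetric] by (rule fold_map_folded) (simp add: folded_def cmod_corner)
qed

lemma card_stab_fundamental:
  assumes "u \<in> fundamental_domain"
  shows "finite (stab u)" "card (stab u) = (if fold_map u = 1 then 2 else if fold_map u = -1 then 3 else 1)"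
proof -
  note fundamental_domain_uhp[OF assms]
  \<comment> \<open>The test point 2 i lies in the interior of the fundamental domain and its images
    under the listed matrices are easily computed.\<close>
  have neq: "modular_isom g \<noteq> modular_isom h" if "mob g (2 * \<i>) \<noteq> mob h (2 * \<i>)" "g \<in> SL2Z" "h \<in> SL2Z" for g h
    using modular_isom_eq_imp_mob_eq[of g h "2 * \<i>"] that by auto
  have D1: "modular_isom (1, 0, 0, 1) \<noteq> modular_isom (0, -1, 1, 0)"
    by (rule neq) (simp_all add: complex_eq_iff Re_divide Im_divide)
  have D2: "modular_isom (1, 0, 0, 1) \<noteq> modular_isom (1, -1, 1, 0)"
    "modular_isom (1, 0, 0, 1) \<noteq> modular_isom (0, -1, 1, -1)"
    "modular_isom (1, -1, 1, 0) \<noteq> modular_isom (0, -1, 1, -1)"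
    by (rule neq; simp add: complex_eq_iff Re_divide Im_divide)+
  have D3: "modular_isom (1, 0, 0, 1) \<noteq> modular_isom (-1, -1, 1, 0)"
    "modular_isom (1, 0, 0, 1) \<noteq> modular_isom (0, -1, 1, 1)"
    "modular_isom (-1, -1, 1, 0) \<noteq> modular_isom (0, -1, 1, 1)"
    by (rule neq; simp add: complex_eq_iff Re_divide Im_divide)+
  have abs1: "x = 1 \<or> x = -1" if "\<bar>x\<bar> = 1" for x :: int using that by linarith
  consider "u = \<i>" | "u = corner" | "u = - cnj corner" | "u \<noteq> \<i>" "u \<noteq> corner" "u \<noteq> - cnj corner" by blast
  then have "finite (stab u) \<and> card (stab u) = (if fold_map u = 1 then 2 else if fold_map u = -1 then 3 else 1)"
  proof cases
    case 1
    have "stab u = modular_isom ` set [(1, 0, 0, 1), (0, -1, 1, 0)]"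
    proof (rule stab_eq_image)
      fix a b c d assume "(a, b, c, d) \<in> SL2Z" "mob (a, b, c, d) u = u"
      then show "(a, b, c, d) \<in> set [(1, 0, 0, 1), (0, -1, 1, 0)] \<or>
          (- a, - b, - c, - d) \<in> set [(1, 0, 0, 1), (0, -1, 1, 0)]"
        by (rule fundamental_domain_stabilizer[OF assms]) (use 1 in \<open>auto dest!: abs1\<close>)
    qed (use 1 in auto)
    then show ?thesis using D1 fold_map_special 1 by simp
  next
    case 2
    have e: "corner * corner = corner - 1" by (simp add: corner_def complex_eq_iff)
    have n: "corner \<noteq> 0" "corner \<noteq> 1" by (simp_all add: corner_def complex_eq_iff)
    have r: "Re corner = 1/2" by (simp add: corner_def)
    \<comment> \<open>The identity, a rotation of order 3 and its inverse; the product of the last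
      two matrices is minus the identity.\<close>
    have "stab u = modular_isom ` set [(1, 0, 0, 1), (1, -1, 1, 0), (0, -1, 1, -1)]"
    proof (rule stab_eq_image)
      fix a b c d assume "(a, b, c, d) \<in> SL2Z" "mob (a, b, c, d) u = u"
      then show "(a, b, c, d) \<in> set [(1, 0, 0, 1), (1, -1, 1, 0), (0, -1, 1, -1)] \<or>
          (- a, - b, - c, - d) \<in> set [(1, 0, 0, 1), (1, -1, 1, 0), (0, -1, 1, -1)]"
        by (rule fundamental_domain_stabilizer[OF assms]) (use 2 r in \<open>auto dest!: abs1\<close>)
    qed (use 2 e n \<open>Im u > 0\<close> in \<open>auto simp: field_simps\<close>)
    then show ?thesis using D2 fold_map_special 2 by simp
  next
    case 3
    have e: "u * u + u + 1 = 0" unfolding 3 by (simp add: corner_def complex_eq_iff)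
    have n: "u \<noteq> 0" "u + 1 \<noteq> 0" unfolding 3 by (simp_all add: corner_def complex_eq_iff)
    have m: "mob (-1, -1, 1, 0) u = u" "mob (0, -1, 1, 1) u = u"
      using n by (simp_all add: field_simps) (use e in algebra)+
    have r: "Re u = -1/2" by (simp add: 3 corner_def)
    have "stab u = modular_isom ` set [(1, 0, 0, 1), (-1, -1, 1, 0), (0, -1, 1, 1)]"
    proof (rule stab_eq_image)
      fix a b c d assume "(a, b, c, d) \<in> SL2Z" "mob (a, b, c, d) u = u"
      then show "(a, b, c, d) \<in> set [(1, 0, 0, 1), (-1, -1, 1, 0), (0, -1, 1, 1)] \<or>
          (- a, - b, - c, - d) \<in> set [(1, 0, 0, 1), (-1, -1, 1, 0), (0, -1, 1, 1)]"
        by (rule fundamental_domain_stabilizer[OF assms]) (use r in \<open>auto dest!: abs1\<close>)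
    qed (use m \<open>Im u > 0\<close> in auto)
    then show ?thesis using D3 fold_map_special 3 by simp
  next
    case 4
    have n: "\<not> (cmod u = 1 \<and> (Re u = 0 \<or> Re u = 1/2 \<or> Re u = -1/2))"
      using unit_fundamental_cases[OF assms] 4 by blast
    have R: "\<bar>Re u\<bar> \<le> 1/2" using assms by (simp add: fundamental_domain_def)
    have "stab u = modular_isom ` set [(1, 0, 0, 1)]"
    proof (rule stab_eq_image)
      fix a b c d assume "(a, b, c, d) \<in> SL2Z" "mob (a, b, c, d) u = u"
      then show "(a, b, c, d) \<in> set [(1, 0, 0, 1)] \<or> (- a, - b, - c, - d) \<in> set [(1, 0, 0, 1)]"
      proof (rule fundamental_domain_stabilizer[OF assms], goal_cases)
        case 1
        then show ?case by (auto dest!: abs1)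
      next
        case 2
        have "\<bar>real_of_int (a * c)\<bar> \<le> 1" using R 2 by simp
        then have "a * c = 0 \<or> a * c = 1 \<or> a * c = -1" by linarith
        then show ?case using 2 n by (auto simp flip: of_int_mult)
      next
        case 3
        then show ?case using n by (auto dest!: abs1)
      qed
    qed (use \<open>Im u > 0\<close> in auto)
    \<comment> \<open>The special values do not recur: i is folded only to itself, and a corner only
      to the two corners.\<close>
    moreover have "fold_map u \<noteq> 1"
      using fold_map_eq_imp_folded[of "\<i>" u] corner_fundamental assms 4 fold_map_special by (auto simp: folded_def)
    moreover have "fold_map u \<noteq> -1"
      using fold_map_eq_imp_folded[of corner u] corner_fundamental assms 4 fold_map_special by (auto simp: folded_def)
    ultimately show ?thesis by simp
  qed
  then show "finite (stab u)" "card (stab u) = (if fold_map u = 1 then 2 else if fold_map u = -1 then 3 else 1)"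
    by blast+
qed

lemma card_stab:
  assumes "Im z > 0"
  shows "finite (stab z)" "card (stab z) = (if orbit_map z = 1 then 2 else if orbit_map z = -1 then 3 else 1)"
proof -
  obtain g where g: "g \<in> SL2Z" "mob g z = reduced z" using reduced[OF assms] by blast
  show "finite (stab z)" "card (stab z) = (if orbit_map z = 1 then 2 else if orbit_map z = -1 then 3 else 1)"
    using card_stab_mob[OF assms g(1)] card_stab_fundamental[OF reduced(1)[OF assms]]
    unfolding g(2) orbit_map_def by simp_all
qed

section \<open>The holonomy group\<close>

abbreviation modular_isoms :: "(real^3^3) set" where
  "modular_isoms \<equiv> modular_isom ` SL2Z"

lemma modular_isom_hyp_plane: "v \<in> hyp_plane \<Longrightarrow> g \<in> SL2Z \<Longrightarrow> modular_isom g *v v \<in> hyp_plane"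
  and hyp_chart_modular_isom:
    "v \<in> hyp_plane \<Longrightarrow> g \<in> SL2Z \<Longrightarrow> hyp_chart (modular_isom g *v v) = mob g (hyp_chart v)"
  using modular_isom_hyp_plane_chart by blast+

lemma hyp_chart_eq_iff:
  "u \<in> hyp_plane \<Longrightarrow> v \<in> hyp_plane \<Longrightarrow> hyp_chart u = hyp_chart v \<longleftrightarrow> u = v"
  by (metis hyp_chart_inv_chart)

lemma modular_isom_eq_iff:
  assumes "u \<in> hyp_plane" "v \<in> hyp_plane" "g \<in> SL2Z"
  shows "modular_isom g *v u = v \<longleftrightarrow> mob g (hyp_chart u) = hyp_chart v"
  using assms by (metis hyp_chart_modular_isom modular_isom_hyp_plane hyp_chart_eq_iff)

lemma trefoil_image: "(c_map \<circ> rho1) ` carrier trefoil_group = modular_isoms"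
  unfolding image_comp[symmetric] rho1_image by (simp add: image_image)

lemma subgroup_modular_isoms: "subgroup modular_isoms SO12_0"
proof -
  interpret group_hom trefoil_group SO12_0 "c_map \<circ> rho1"
    by (intro group_hom.intro group_hom_axioms.intro group_SO12_0 hom_compose[OF rho1_hom c_map_hom])
      (simp add: trefoil_group_def group_presented_group)
  show ?thesis using img_is_subgroup unfolding trefoil_image .
qed

text \<open>On a compact set the chart has bounded modulus and its height attains a positive
  minimum, so only the matrices of \<open>finite_SL2Z_returns\<close> can map the set to meet
  itself.\<close>

lemma properly_discontinuous_modular_isoms: "properly_discontinuous modular_isoms"
  unfolding properly_discontinuous_def
proof (intro allI impI, elim conjE)
  fix K assume K: "compact K" "K \<subseteq> hyp_plane"
  show "finite {M \<in> modular_isoms. ((\<lambda>v. M *v v) ` K) \<inter> K \<noteq> {}}"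
  proof (cases "K = {}")
    case False
    have "compact (hyp_chart ` K)"
      using K continuous_on_subset[OF continuous_on_hyp_chart] by (intro compact_continuous_image)
    then have "bounded (hyp_chart ` K)" by (rule compact_imp_bounded)
    then obtain B where B: "\<And>v. v \<in> K \<Longrightarrow> cmod (hyp_chart v) \<le> B" by (auto simp: bounded_iff)
    have "continuous_on K (\<lambda>v. Im (hyp_chart v))"
      using continuous_on_subset[OF continuous_on_hyp_chart K(2)] by (intro continuous_intros)
    then obtain v0 where v0: "v0 \<in> K" "\<And>v. v \<in> K \<Longrightarrow> Im (hyp_chart v0) \<le> Im (hyp_chart v)"
      using continuous_attains_inf[OF K(1) False] by blast
    define e where "e = Im (hyp_chart v0)"
    have "e > 0" using v0 K hyp_chart_pos by (auto simp: e_def)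
    have "{M \<in> modular_isoms. (\<lambda>v. M *v v) ` K \<inter> K \<noteq> {}} \<subseteq> modular_isom `
        {g \<in> SL2Z. \<exists>z. Im z \<ge> e \<and> cmod z \<le> B \<and> Im (mob g z) \<ge> e \<and> cmod (mob g z) \<le> B}"
    proof
      fix M assume "M \<in> {M \<in> modular_isoms. ((\<lambda>v. M *v v) ` K) \<inter> K \<noteq> {}}"
      then obtain g v where g: "g \<in> SL2Z" and v: "v \<in> K" "modular_isom g *v v \<in> K" and M: "M = modular_isom g"
        by blast
      have "hyp_chart (modular_isom g *v v) = mob g (hyp_chart v)"
        using v g K by (intro hyp_chart_modular_isom) auto
      then have "Im (hyp_chart v) \<ge> e \<and> cmod (hyp_chart v) \<le> B \<and>
          Im (mob g (hyp_chart v)) \<ge> e \<and> cmod (mob g (hyp_chart v)) \<le> B"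
        using v0 B v e_def by metis
      then show "M \<in> modular_isom `
          {g \<in> SL2Z. \<exists>z. Im z \<ge> e \<and> cmod z \<le> B \<and> Im (mob g z) \<ge> e \<and> cmod (mob g z) \<le> B}"
        using g unfolding M by (intro imageI) blast
    qed
    then show ?thesis
      by (rule finite_subset) (intro finite_imageI finite_SL2Z_returns \<open>e > 0\<close>)
  qed simp
qed

lemma conjugate_modular_isoms: "conjugate_to_modular_group modular_isoms"
  unfolding conjugate_to_modular_group_def
proof (intro exI conjI ballI)
  show "bij_betw hyp_chart hyp_plane upper_half_plane" by (rule hyp_chart_bij)
  show "uhp_dist (hyp_chart u) (hyp_chart v) = hyp_dist u v" if "u \<in> hyp_plane" "v \<in> hyp_plane" for u v
    using that by (rule uhp_dist_hyp_chart)
  have inv: "the_inv_into hyp_plane hyp_chart z = hyp_chart_inv z" if "z \<in> upper_half_plane" for z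
    using that hyp_chart_bij hyp_chart_inv_in hyp_chart_chart_inv
    by (intro the_inv_into_f_eq) (auto simp: bij_betw_def)
  have "restrict (\<lambda>z. hyp_chart (modular_isom g *v the_inv_into hyp_plane hyp_chart z)) upper_half_plane =
      restrict (mob g) upper_half_plane" if "g \<in> SL2Z" for g
    using that by (intro restrict_ext) (auto simp: inv hyp_chart_modular_isom hyp_chart_inv_in hyp_chart_chart_inv)
  then have "(\<lambda>M. restrict (\<lambda>z. hyp_chart (M *v the_inv_into hyp_plane hyp_chart z)) upper_half_plane) ` modular_isoms =
      (\<lambda>g. restrict (mob g) upper_half_plane) ` SL2Z"
    unfolding image_image by (intro image_cong) auto
  also have "\<dots> = modular_group"
  proof -
    have "restrict (mob (a, b, c, d)) upper_half_plane =
        restrict (\<lambda>z. (of_int a * z + of_int b) / (of_int c * z + of_int d)) upper_half_plane" for a b c d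
      by (simp add: mob.simps[abs_def])
    then show ?thesis unfolding modular_group_def SL2Z_def image_def by (auto; metis)
  qed
  finally show "(\<lambda>M. restrict (\<lambda>z. hyp_chart (M *v the_inv_into hyp_plane hyp_chart z)) upper_half_plane) ` modular_isoms =
      modular_group" .
qed

lemma orbifold_modular_isoms:
  "\<exists>n p2 p3 :: real^3. {n, p2, p3} \<subseteq> sphere 0 1 \<and> n \<noteq> p2 \<and> n \<noteq> p3 \<and> p2 \<noteq> p3 \<and>
     quotient_is_cone_orbifold modular_isoms (top_of_set (sphere 0 1 - {n}))
       (\<lambda>x. if x = p2 then 2 else if x = p3 then 3 else 1)"
proof -
  define n :: "real^3" where "n = axis 1 1"
  have n: "norm n = 1" by (simp add: n_def)
  obtain h :: "complex \<Rightarrow> real^3" where h: "homeomorphic_map euclidean (top_of_set (sphere 0 1 - {n})) h"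
    using punctured_sphere_homeomorphism[OF n] .
  have hq: "quotient_map euclidean (top_of_set (sphere 0 1 - {n})) h" and inj: "inj h"
    using h by (auto simp: homeomorphic_map_def)
  have h_in: "h y \<in> sphere 0 1 - {n}" for y
    using homeomorphic_imp_surjective_map[OF h] rangeI[of h y] by simp
  have h_eq: "h x = h y \<longleftrightarrow> x = y" for x y using inj by (simp add: inj_eq)
  define q where "q = h \<circ> (orbit_map \<circ> hyp_chart)"
  \<comment> \<open>\<open>orbit_map\<close> takes the value 1 exactly on the orbit of i and the
    value -1 exactly on the orbit of the corners, so \<open>h 1\<close> and \<open>h (-1)\<close>
    are the cone points.\<close>
  have "quotient_is_cone_orbifold modular_isoms (top_of_set (sphere 0 1 - {n}))
      (\<lambda>x. if x = h 1 then 2 else if x = h (-1) then 3 else 1)"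
    unfolding quotient_is_cone_orbifold_def
  proof (intro exI conjI ballI)
    show "quotient_map (top_of_set hyp_plane) (top_of_set (sphere 0 1 - {n})) q"
      unfolding q_def using quotient_map_orbit_map hq by (rule quotient_map_compose)
  next
    fix u v assume "u \<in> hyp_plane" "v \<in> hyp_plane"
    then show "q u = q v \<longleftrightarrow> (\<exists>M\<in>modular_isoms. M *v u = v)"
      by (auto simp: q_def h_eq orbit_map_eq_iff hyp_chart_pos modular_isom_eq_iff simp del: mob.simps)
  next
    fix u assume u: "u \<in> hyp_plane"
    have "{M \<in> modular_isoms. M *v u = u} = stab (hyp_chart u)"
      unfolding stab_def using u modular_isom_eq_iff[of u u] by blast
    then show "finite {M \<in> modular_isoms. M *v u = u}"
      "card {M \<in> modular_isoms. M *v u = u} = (if q u = h 1 then 2 else if q u = h (- 1) then 3 else 1)"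
      using card_stab[OF hyp_chart_pos[OF u]] by (simp_all add: q_def h_eq)
  qed
  moreover have "{n, h 1, h (-1)} \<subseteq> sphere 0 1" "n \<noteq> h 1" "n \<noteq> h (-1)" "h 1 \<noteq> h (-1)"
    using h_in[of 1] h_in[of "-1"] n h_eq by auto
  ultimately show ?thesis by blast
qed

section \<open>Finite area\<close>

definition cusp_region :: "(real^3) set" where
  "cusp_region = {v \<in> hyp_plane. v$1 - v$2 \<le> 1 \<and> \<bar>v$3\<bar> \<le> v$1 - v$2}"

text \<open>In the chart \<open>cusp_region\<close> is the half strip |Re w| <= 1/2, Im w >= 1/2. It
  replaces the arc of the fundamental domain by a lower horizontal edge, so that on the hyperboloid
  only linear inequalities occur.\<close>

lemma hyp_chart_fundamental_cusp:
  assumes "v \<in> hyp_plane" "hyp_chart v \<in> fundamental_domain"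
  shows "v \<in> cusp_region"
proof -
  have u: "v$1 - v$2 > 0" using assms(1) by (simp add: hyp_plane_iff)
  have "1 / (2 * (v$1 - v$2)) \<ge> 3/4"
    using fundamental_domain_Im[OF assms(2)] by (simp add: hyp_chart_def)
  then have "v$1 - v$2 \<le> 1" using u by (simp add: field_simps)
  moreover have "\<bar>v$3\<bar> / (2 * (v$1 - v$2)) \<le> 1/2"
    using assms(2) u by (simp add: fundamental_domain_def hyp_chart_def)
  then have "\<bar>v$3\<bar> \<le> v$1 - v$2" using u by (simp add: field_simps)
  ultimately show ?thesis using assms(1) by (simp add: cusp_region_def)
qed

lemma cusp_region_borel: "cusp_region \<in> sets borel"
proof -
  \<comment> \<open>The strict inequality v1 - v2 > 0 may be relaxed, because the product 1 + v3^2
    is never 0. The region is therefore closed.\<close>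
  have "cusp_region = {v. 0 \<le> v$1 - v$2} \<inter> {v. (v$1 - v$2) * (v$1 + v$2) = 1 + (v$3)\<^sup>2} \<inter>
      {v. v$1 - v$2 \<le> 1} \<inter> {v. \<bar>v$3\<bar> \<le> v$1 - v$2}" (is "_ = ?R")
  proof -
    have "0 < v$1 - v$2" if "0 \<le> v$1 - v$2" "(v$1 - v$2) * (v$1 + v$2) = 1 + (v$3)\<^sup>2" for v :: "real^3"
    proof -
      have "1 + (v$3)\<^sup>2 > 0" by (simp add: add_pos_nonneg)
      then have "v$1 - v$2 \<noteq> 0" using that(2) by auto
      then show ?thesis using that(1) by linarith
    qed
    then show ?thesis unfolding cusp_region_def hyp_plane_iff by force
  qed
  moreover have "closed ?R"
    by (intro closed_Int closed_Collect_le closed_Collect_eq continuous_intros)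
  ultimately show ?thesis by (simp add: borel_closed)
qed

text \<open>Since |z| <= x - y and (x - y)(x + y) = 1 + z^2 <= 2, the region lies in y >= 0 and
  narrows like 1 / y towards the cusp.\<close>

lemma cusp_region_bounds:
  assumes "vector [sqrt (1 + y\<^sup>2 + z\<^sup>2), y, z] \<in> cusp_region"
  shows "0 \<le> y" "\<bar>z\<bar> * sqrt (1 + y\<^sup>2) \<le> 2"
proof -
  define x where "x = sqrt (1 + y\<^sup>2 + z\<^sup>2)"
  have u: "x - y > 0" "(x - y) * (x + y) = 1 + z\<^sup>2" "x - y \<le> 1" "\<bar>z\<bar> \<le> x - y"
    using assms unfolding cusp_region_def x_def[symmetric] by (auto simp: hyp_plane_iff)
  have "x \<ge> 0" by (simp add: x_def)
  have "x + y > 0"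
  proof -
    have "(x - y) * (x + y) > 0" unfolding u(2) by (simp add: add_pos_nonneg)
    then show ?thesis using u(1) by (simp add: zero_less_mult_iff)
  qed
  then have "(x - y) * (x + y) \<le> 1 * (x + y)" using u(3) by (intro mult_right_mono) auto
  then have "x + y \<ge> 1" unfolding u(2) by (smt (verit) zero_le_power2)
  then show "0 \<le> y" using u(3) by linarith
  have "\<bar>z\<bar> * sqrt (1 + y\<^sup>2) \<le> (x - y) * (x + y)"
  proof (rule mult_mono)
    have "sqrt (1 + y\<^sup>2) \<le> x" by (simp add: x_def)
    then show "sqrt (1 + y\<^sup>2) \<le> x + y" using \<open>0 \<le> y\<close> by linarith
  qed (use u in auto)
  also have "\<dots> \<le> 2"
  proof -
    have "\<bar>z\<bar> \<le> 1" using u by linarith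
    then have "z\<^sup>2 \<le> 1" by (simp add: abs_square_le_1)
    then show ?thesis unfolding u(2) by simp
  qed
  finally show "\<bar>z\<bar> * sqrt (1 + y\<^sup>2) \<le> 2" .
qed

text \<open>The density is at most 1 / sqrt (1 + y^2) and the slice at y has length at most 4 / sqrt
  (1 + y^2). Their product 4 / (1 + y^2) is integrated by the arctangent, which bounds the area by 2
  pi.\<close>

lemma hyp_area_cusp_region: "hyp_area cusp_region < \<infinity>"
proof -
  define S where "S = {p :: real \<times> real. 0 \<le> fst p \<and> \<bar>snd p\<bar> * sqrt (1 + (fst p)\<^sup>2) \<le> 2}"
  define f where "f = (\<lambda>p :: real \<times> real. ennreal (1 / sqrt (1 + (fst p)\<^sup>2)) * indicator S p)"
  have pos: "sqrt (1 + y\<^sup>2) > 0" for y :: real by (simp add: add_pos_nonneg)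
  have "closed S"
    unfolding S_def by (intro closed_Collect_conj closed_Collect_le continuous_intros)
  then have "S \<in> sets borel" by (rule borel_closed)
  moreover have "(\<lambda>p :: real \<times> real. 1 / sqrt (1 + (fst p)\<^sup>2)) \<in> borel_measurable borel"
    using pos by (intro borel_measurable_continuous_onI continuous_intros) (metis less_irrefl)
  ultimately have f: "f \<in> borel_measurable borel"
    unfolding f_def by measurable
  have "hyp_area cusp_region \<le> (\<integral>\<^sup>+ p. f p \<partial>lborel)"
    unfolding hyp_area_def
  proof (intro nn_integral_mono, clarify)
    fix y z :: real
    show "indicator cusp_region (vector [sqrt (1 + y\<^sup>2 + z\<^sup>2), y, z]) * ennreal (1 / sqrt (1 + y\<^sup>2 + z\<^sup>2))
        \<le> f (y, z)"
    proof (cases "vector [sqrt (1 + y\<^sup>2 + z\<^sup>2), y, z] \<in> cusp_region")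
      case True
      have "1 / sqrt (1 + y\<^sup>2 + z\<^sup>2) \<le> 1 / sqrt (1 + y\<^sup>2)"
        using pos[of y] by (intro divide_left_mono mult_pos_pos) (auto intro!: add_pos_nonneg)
      moreover have "(y, z) \<in> S" using cusp_region_bounds[OF True] by (simp add: S_def)
      ultimately show ?thesis using True by (simp add: f_def ennreal_leI)
    qed simp
  qed
  also have "\<dots> = (\<integral>\<^sup>+ y. \<integral>\<^sup>+ z. f (y, z) \<partial>lborel \<partial>lborel)"
  proof -
    have "f \<in> borel_measurable (lborel \<Otimes>\<^sub>M lborel)" using f by (simp add: lborel_prod)
    from lborel.nn_integral_fst[OF this] show ?thesis by (simp add: lborel_prod)
  qed
  also have "\<dots> = (\<integral>\<^sup>+ y. ennreal (4 / (1 + y\<^sup>2)) * indicator {0..} y \<partial>lborel)"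
  proof (intro nn_integral_cong)
    fix y :: real
    define r where "r = sqrt (1 + y\<^sup>2)"
    have r: "r > 0" "r * r = 1 + y\<^sup>2" using pos[of y] by (simp_all add: r_def)
    have "f (y, z) = ennreal (1 / r) * indicator {0..} y * indicator {-(2/r)..2/r} z" for z
    proof -
      have "\<bar>z\<bar> * r \<le> 2 \<longleftrightarrow> z \<in> {-(2/r)..2/r}"
        using r(1) by (auto simp: abs_le_iff simp flip: pos_le_divide_eq)
      then show ?thesis by (auto simp: f_def S_def r_def[symmetric] indicator_def)
    qed
    then have "(\<integral>\<^sup>+ z. f (y, z) \<partial>lborel) = ennreal (1 / r) * indicator {0..} y * emeasure lborel {-(2/r)..2/r}"
      by (simp add: nn_integral_cmult_indicator)
    also have "emeasure lborel {-(2/r)..2/r} = ennreal (4 / r)" using r by simp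
    also have "ennreal (1 / r) * indicator {0..} y * ennreal (4 / r) = ennreal (1 / r * (4 / r)) * indicator {0..} y"
      using r by (subst ennreal_mult) (auto simp: mult_ac)
    also have "1 / r * (4 / r) = 4 / (1 + y\<^sup>2)" by (simp add: r(2))
    finally show "(\<integral>\<^sup>+ z. f (y, z) \<partial>lborel) = ennreal (4 / (1 + y\<^sup>2)) * indicator {0..} y" .
  qed
  also have "\<dots> = ennreal (4 * (pi / 2) - 4 * arctan 0)"
  proof (rule nn_integral_FTC_atLeast)
    show "(\<lambda>y :: real. 4 / (1 + y\<^sup>2)) \<in> borel_measurable borel" by measurable
    show "((\<lambda>y. 4 * arctan y) \<longlongrightarrow> 4 * (pi / 2)) at_top"
      by (intro tendsto_mult tendsto_const tendsto_arctan_at_top)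
    show "DERIV (\<lambda>y. 4 * arctan y) y :> 4 / (1 + y\<^sup>2)" for y :: real
      by (auto intro!: derivative_eq_intros simp: field_simps)
    show "0 \<le> 4 / (1 + y\<^sup>2)" for y :: real by simp
  qed
  finally show ?thesis by (rule le_less_trans) simp
qed

lemma finite_coarea_modular_isoms: "finite_coarea modular_isoms"
  unfolding finite_coarea_def
proof (intro bexI[of _ cusp_region] conjI ballI)
  show "cusp_region \<subseteq> hyp_plane" by (auto simp: cusp_region_def)
  fix p assume p: "p \<in> hyp_plane"
  obtain g where g: "g \<in> SL2Z" "mob g (hyp_chart p) \<in> fundamental_domain"
    using exists_reduced[OF hyp_chart_pos[OF p]] by blast
  then have "modular_isom g *v p \<in> cusp_region"
    using modular_isom_hyp_plane_chart[OF p g(1)] hyp_chart_fundamental_cusp by metis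
  then show "\<exists>M\<in>modular_isoms. M *v p \<in> cusp_region" using g(1) by blast
qed (rule hyp_area_cusp_region cusp_region_borel)+

theorem theorem5:
  shows "holonomy_group_of_S2_2_3_inf ((c_map \<circ> rho1) ` carrier trefoil_group) \<and>
         conjugate_to_modular_group ((c_map \<circ> rho1) ` carrier trefoil_group)"
  unfolding trefoil_image holonomy_group_of_S2_2_3_inf_def
  by (intro conjI subgroup_modular_isoms properly_discontinuous_modular_isoms
      finite_coarea_modular_isoms orbifold_modular_isoms conjugate_modular_isoms)

end
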